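(* Let $M$ be a closed, connected $C^\infty$ manifold of dimension $d\ge 1$, let $H:T^*M\to\mathbb{R}$ be a Hamiltonian of class $C^r$ with $r\ge 1$, let $\Gamma\subset T^*M$ be a Lagrangian graph of class $C^1$, and let $\Lambda\subseteq\Gamma$ be a compact, connected set that is invariant under the Hamiltonian flow $\phi^t_H$. Define $h:M\to\mathbb{R}$ by $h(q):=H(q,\Gamma(q))$. Suppose that $h\in C^{d',s}(M,\mathbb{R})$, where $d'\ge 0$ is an integer and $s\in[0,1]$, and where either $d'\ge d$, or $d'=d-1$ and $s=1$. Then $H$ is constant on $\Lambda$.
   Context: $T^*M$ carries its canonical symplectic form $\omega$; $X_H$ is the Hamiltonian vector field of $H$, given in canonical local coordinates $(q,p)$ by $\dot q=\partial H/\partial p$, $\dot p=-\partial H/\partial q$, and $\phi^t_H$ is its flow. A set $\Lambda\subset T^*M$ is invariant under $\phi^t_H$ if $\phi^t_H(\Lambda)=\Lambda$ for all $t\in\mathbb{R}$. If $H$ is only $C^1$, so that $X_H$ is merely continuous and its integral curves need not be unique, this is understood to mean that through every point of $\Lambda$ there passes an integral curve $\mathbb{R}\to T^*M$ of $X_H$ contained in $\Lambda$. A Lagrangian graph of class $C^1$ is the image of a $C^1$ section $q\mapsto(q,\Gamma(q))$ of $T^*M\to M$ such that $\Gamma$ is a closed 1-form (locally the differential of a $C^2$ function); the same letter $\Gamma$ denotes the section and its image. $C^{d',s}$ denotes the functions that are $d'$ times continuously differentiable and whose derivatives of order $d'$ in local charts are locally Hölder continuous with exponent $s$ (Lipschitz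 if $s=1$; no condition beyond continuity if $s=0$). *)

theory Defs
  imports "HOL-Analysis.Analysis"
begin

section \<open>Differentiability classes on open subsets of Euclidean space\<close>

primrec Cn_on :: "nat \<Rightarrow> 'e::euclidean_space set \<Rightarrow> ('e \<Rightarrow> 'f::real_normed_vector) \<Rightarrow> bool" where
  "Cn_on 0 S f \<longleftrightarrow> continuous_on S f"
| "Cn_on (Suc n) S f \<longleftrightarrow> (\<forall>x\<in>S. f differentiable (at x)) \<and>
     (\<forall>v. Cn_on n S (\<lambda>x. frechet_derivative f (at x) v))"

definition Cr_on :: "enat \<Rightarrow> 'e::euclidean_space set \<Rightarrow> ('e \<Rightarrow> 'f::real_normed_vector) \<Rightarrow> bool" where
  "Cr_on r S f \<longleftrightarrow> (\<forall>n. enat n \<le> r \<longrightarrow> Cn_on n S f)"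

text \<open>Since \<open>x powr 0 = 1\<close> for \<open>x > 0\<close>, exponent 0 only asks for local boundedness,
  which is implied by continuity.\<close>

definition locally_holder_on :: "real \<Rightarrow> 'e::euclidean_space set \<Rightarrow> ('e \<Rightarrow> 'f::real_normed_vector) \<Rightarrow> bool" where
  "locally_holder_on s S f \<longleftrightarrow> (\<forall>x\<in>S. \<exists>e>0. \<exists>C. \<forall>y\<in>S \<inter> ball x e. \<forall>z\<in>S \<inter> ball x e.
      dist (f y) (f z) \<le> C * dist y z powr s)"

primrec Cns_on :: "nat \<Rightarrow> real \<Rightarrow> 'e::euclidean_space set \<Rightarrow> ('e \<Rightarrow> 'f::real_normed_vector) \<Rightarrow> bool" where
  "Cns_on 0 s S f \<longleftrightarrow> continuous_on S f \<and> locally_holder_on s S f"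
| "Cns_on (Suc n) s S f \<longleftrightarrow> (\<forall>x\<in>S. f differentiable (at x)) \<and>
     (\<forall>v. Cns_on n s S (\<lambda>x. frechet_derivative f (at x) v))"


section \<open>Smooth manifolds\<close>

text \<open>A chart is a pair of its domain and its coordinate map; the values of the coordinate map
  outside the domain are irrelevant.\<close>

type_synonym ('a, 'd) chart = "'a set \<times> ('a \<Rightarrow> real ^ 'd)"

abbreviation cdom :: "('a, 'd) chart \<Rightarrow> 'a set" where "cdom \<equiv> fst"
abbreviation cmap :: "('a, 'd) chart \<Rightarrow> 'a \<Rightarrow> real ^ 'd" where "cmap \<equiv> snd"

abbreviation cran :: "('a, 'd) chart \<Rightarrow> (real ^ 'd) set" where "cran c \<equiv> cmap c ` cdom c"

definition cinv :: "('a, 'd) chart \<Rightarrow> real ^ 'd \<Rightarrow> 'a" where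
  "cinv c = inv_into (cdom c) (cmap c)"

definition is_chart :: "'a topology \<Rightarrow> ('a, 'd::finite) chart \<Rightarrow> bool" where
  "is_chart M c \<longleftrightarrow> openin M (cdom c) \<and> open (cran c) \<and>
     homeomorphic_map (subtopology M (cdom c)) (top_of_set (cran c)) (cmap c)"

definition transition :: "('a, 'd) chart \<Rightarrow> ('a, 'd) chart \<Rightarrow> real ^ 'd \<Rightarrow> real ^ 'd" where
  "transition c c' = cmap c' \<circ> cinv c"

text \<open>The atlas need not be maximal: all notions below give the same result for any two
  smoothly compatible atlases.\<close>

definition smooth_atlas :: "'a topology \<Rightarrow> ('a, 'd::finite) chart set \<Rightarrow> bool" where
  "smooth_atlas M A \<longleftrightarrow> (\<forall>c\<in>A. is_chart M c) \<and> topspace M = (\<Union>c\<in>A. cdom c) \<and>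
     (\<forall>c\<in>A. \<forall>c'\<in>A. Cr_on \<infinity> (cmap c ` (cdom c \<inter> cdom c')) (transition c c'))"

definition closed_manifold :: "'a topology \<Rightarrow> ('a, 'd::finite) chart set \<Rightarrow> bool" where
  "closed_manifold M A \<longleftrightarrow> smooth_atlas M A \<and>
     Hausdorff_space M \<and> second_countable M \<and> compact_space M"

definition Cr_fun_on :: "enat \<Rightarrow> ('a, 'd::finite) chart set \<Rightarrow> 'a set \<Rightarrow> ('a \<Rightarrow> real) \<Rightarrow> bool" where
  "Cr_fun_on r A V f \<longleftrightarrow> (\<forall>c\<in>A. Cr_on r (cmap c ` (V \<inter> cdom c)) (f \<circ> cinv c))"

definition Cns_fun :: "nat \<Rightarrow> real \<Rightarrow> ('a, 'd::finite) chart set \<Rightarrow> ('a \<Rightarrow> real) \<Rightarrow> bool" where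
  "Cns_fun n s A f \<longleftrightarrow> (\<forall>c\<in>A. Cns_on n s (cran c) (f \<circ> cinv c))"


section \<open>The cotangent bundle\<close>

text \<open>A covector at \<open>q\<close> is the family of its coordinate vectors in all charts around \<open>q\<close>,
  subject to the covariant transformation law (stated as invariance of the pairing with tangent
  vectors). The value at a chart not containing \<open>q\<close> is normalised to 0, so that equality of
  covectors is equality of functions.\<close>

type_synonym ('a, 'd) covector = "('a, 'd) chart \<Rightarrow> real ^ 'd"

definition cotangent_space :: "('a, 'd::finite) chart set \<Rightarrow> 'a \<Rightarrow> ('a, 'd) covector set" where
  "cotangent_space A q = {p.
     (\<forall>c\<in>A. \<forall>c'\<in>A. q \<in> cdom c \<longrightarrow> q \<in> cdom c' \<longrightarrow>
        (\<forall>v. p c \<bullet> v = p c' \<bullet> frechet_derivative (transition c c') (at (cmap c q)) v)) \<and>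
     (\<forall>c. \<not> (c \<in> A \<and> q \<in> cdom c) \<longrightarrow> p c = 0)}"

definition cotangent_bundle :: "'a topology \<Rightarrow> ('a, 'd::finite) chart set \<Rightarrow> ('a \<times> ('a, 'd) covector) set" where
  "cotangent_bundle M A = (SIGMA q : topspace M. cotangent_space A q)"

text \<open>Canonical coordinates \<open>(q, p)\<close> induced by a chart of the base, and their inverse.\<close>

definition cot_dom :: "'a topology \<Rightarrow> ('a, 'd::finite) chart set \<Rightarrow> ('a, 'd) chart \<Rightarrow> ('a \<times> ('a, 'd) covector) set" where
  "cot_dom M A c = {z \<in> cotangent_bundle M A. fst z \<in> cdom c}"

definition cot_chart :: "('a, 'd::finite) chart \<Rightarrow> 'a \<times> ('a, 'd) covector \<Rightarrow> (real ^ 'd) \<times> (real ^ 'd)" where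
  "cot_chart c z = (cmap c (fst z), snd z c)"

definition cot_inv :: "'a topology \<Rightarrow> ('a, 'd::finite) chart set \<Rightarrow> ('a, 'd) chart \<Rightarrow>
    (real ^ 'd) \<times> (real ^ 'd) \<Rightarrow> 'a \<times> ('a, 'd) covector" where
  "cot_inv M A c = inv_into (cot_dom M A c) (cot_chart c)"

text \<open>The topology for which all canonical coordinate systems are homeomorphisms onto
  \<open>cran c \<times> UNIV\<close>.\<close>

definition cotangent_topology :: "'a topology \<Rightarrow> ('a, 'd::finite) chart set \<Rightarrow> ('a \<times> ('a, 'd) covector) topology" where
  "cotangent_topology M A = topology (\<lambda>W. W \<subseteq> cotangent_bundle M A \<and>
     (\<forall>c\<in>A. open ((cran c \<times> UNIV) \<inter> cot_inv M A c -` W)))"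

definition Cr_hamiltonian :: "enat \<Rightarrow> 'a topology \<Rightarrow> ('a, 'd::finite) chart set \<Rightarrow>
    ('a \<times> ('a, 'd) covector \<Rightarrow> real) \<Rightarrow> bool" where
  "Cr_hamiltonian r M A H \<longleftrightarrow> (\<forall>c\<in>A. Cr_on r (cran c \<times> UNIV) (H \<circ> cot_inv M A c))"


section \<open>Hamiltonian dynamics\<close>

text \<open>The Hamiltonian vector field in canonical coordinates, \<open>(\<partial>H/\<partial>p, - \<partial>H/\<partial>q)\<close>.\<close>

definition ham_field :: "'a topology \<Rightarrow> ('a, 'd::finite) chart set \<Rightarrow> ('a \<times> ('a, 'd) covector \<Rightarrow> real) \<Rightarrow>
    ('a, 'd) chart \<Rightarrow> (real ^ 'd) \<times> (real ^ 'd) \<Rightarrow> (real ^ 'd) \<times> (real ^ 'd)" where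
  "ham_field M A H c y =
     ((\<chi> i. frechet_derivative (H \<circ> cot_inv M A c) (at y) (0, axis i 1)),
      - (\<chi> i. frechet_derivative (H \<circ> cot_inv M A c) (at y) (axis i 1, 0)))"

text \<open>Continuity of the curve guarantees that it stays in the domain of a chart for a short time,
  so that the derivative in that chart is meaningful.\<close>

definition integral_curve :: "'a topology \<Rightarrow> ('a, 'd::finite) chart set \<Rightarrow> ('a \<times> ('a, 'd) covector \<Rightarrow> real) \<Rightarrow>
    (real \<Rightarrow> 'a \<times> ('a, 'd) covector) \<Rightarrow> bool" where
  "integral_curve M A H \<gamma> \<longleftrightarrow> continuous_map euclideanreal (cotangent_topology M A) \<gamma> \<and>
     (\<forall>t. \<forall>c\<in>A. fst (\<gamma> t) \<in> cdom c \<longrightarrow>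
        ((\<lambda>\<tau>. cot_chart c (\<gamma> \<tau>)) has_vector_derivative ham_field M A H c (cot_chart c (\<gamma> t))) (at t))"

text \<open>The time-\<open>t\<close> map of the flow as a (partial) function graph, defined at the points whose
  integral curve exists for all times.\<close>

definition ham_flow :: "'a topology \<Rightarrow> ('a, 'd::finite) chart set \<Rightarrow> ('a \<times> ('a, 'd) covector \<Rightarrow> real) \<Rightarrow>
    real \<Rightarrow> (('a \<times> ('a, 'd) covector) \<times> ('a \<times> ('a, 'd) covector)) set" where
  "ham_flow M A H t = {(\<gamma> 0, \<gamma> t) | \<gamma>. integral_curve M A H \<gamma>}"

text \<open>For \<open>t = 0\<close> the first alternative says that the flow is complete on \<open>\<Lambda>\<close>. The second
  alternative is for Hamiltonians that are only known to be of class \<open>C\<^sup>1\<close>, whose integral curves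
  need not be unique.\<close>

definition flow_invariant :: "enat \<Rightarrow> 'a topology \<Rightarrow> ('a, 'd::finite) chart set \<Rightarrow>
    ('a \<times> ('a, 'd) covector \<Rightarrow> real) \<Rightarrow> ('a \<times> ('a, 'd) covector) set \<Rightarrow> bool" where
  "flow_invariant r M A H \<Lambda> \<longleftrightarrow>
     (if 2 \<le> r then \<forall>t. ham_flow M A H t `` \<Lambda> = \<Lambda>
      else \<forall>z\<in>\<Lambda>. \<exists>\<gamma>. integral_curve M A H \<gamma> \<and> z \<in> range \<gamma> \<and> range \<gamma> \<subseteq> \<Lambda>)"


section \<open>Lagrangian graphs\<close>

definition differential :: "('a, 'd::finite) chart set \<Rightarrow> ('a \<Rightarrow> real) \<Rightarrow> 'a \<Rightarrow> ('a, 'd) covector" where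
  "differential A f q = (\<lambda>c. if c \<in> A \<and> q \<in> cdom c
     then \<chi> i. frechet_derivative (f \<circ> cinv c) (at (cmap c q)) (axis i 1) else 0)"

definition C1_section :: "'a topology \<Rightarrow> ('a, 'd::finite) chart set \<Rightarrow> ('a \<Rightarrow> ('a, 'd) covector) \<Rightarrow> bool" where
  "C1_section M A \<Gamma> \<longleftrightarrow> (\<forall>q\<in>topspace M. \<Gamma> q \<in> cotangent_space A q) \<and>
     (\<forall>c\<in>A. Cr_on 1 (cran c) (\<lambda>x. \<Gamma> (cinv c x) c))"

definition closed_form :: "'a topology \<Rightarrow> ('a, 'd::finite) chart set \<Rightarrow> ('a \<Rightarrow> ('a, 'd) covector) \<Rightarrow> bool" where
  "closed_form M A \<Gamma> \<longleftrightarrow> (\<forall>q\<in>topspace M. \<exists>V f. openin M V \<and> q \<in> V \<and> Cr_fun_on 2 A V f \<and>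
     (\<forall>x\<in>V. \<Gamma> x = differential A f x))"

definition graph :: "'a topology \<Rightarrow> ('a \<Rightarrow> ('a, 'd) covector) \<Rightarrow> ('a \<times> ('a, 'd) covector) set" where
  "graph M \<Gamma> = (\<lambda>q. (q, \<Gamma> q)) ` topspace M"

definition C1_lagrangian_section :: "'a topology \<Rightarrow> ('a, 'd::finite) chart set \<Rightarrow> ('a \<Rightarrow> ('a, 'd) covector) \<Rightarrow> bool" where
  "C1_lagrangian_section M A \<Gamma> \<longleftrightarrow> C1_section M A \<Gamma> \<and> closed_form M A \<Gamma>"


section \<open>Well-definedness of the cotangent topology and of canonical coordinates\<close>

lemma istopology_cotangent:
  "istopology (\<lambda>W. W \<subseteq> cotangent_bundle M A \<and>
     (\<forall>c\<in>A. open ((cran c \<times> UNIV) \<inter> cot_inv M A c -` W)))"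
proof -
  have "open ((cran c \<times> UNIV) \<inter> cot_inv M A c -` (S \<inter> T))"
    if "open ((cran c \<times> UNIV) \<inter> cot_inv M A c -` S)"
       "open ((cran c \<times> UNIV) \<inter> cot_inv M A c -` T)" for S T c
  proof -
    have "(cran c \<times> UNIV) \<inter> cot_inv M A c -` (S \<inter> T) =
       ((cran c \<times> UNIV) \<inter> cot_inv M A c -` S) \<inter> ((cran c \<times> UNIV) \<inter> cot_inv M A c -` T)" by blast
    moreover have "open (((cran c \<times> UNIV) \<inter> cot_inv M A c -` S) \<inter> ((cran c \<times> UNIV) \<inter> cot_inv M A c -` T))"
      using that by (rule open_Int)
    ultimately show ?thesis by metis
  qed
  moreover have "open ((cran c \<times> UNIV) \<inter> cot_inv M A c -` (\<Union>K))"
    if "\<And>S. S \<in> K \<Longrightarrow> open ((cran c \<times> UNIV) \<inter> cot_inv M A c -` S)" for K c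
  proof -
    have "(cran c \<times> UNIV) \<inter> cot_inv M A c -` (\<Union>K) =
       (\<Union>S\<in>K. (cran c \<times> UNIV) \<inter> cot_inv M A c -` S)" by blast
    moreover have "open (\<Union>S\<in>K. (cran c \<times> UNIV) \<inter> cot_inv M A c -` S)"
      using that by (intro open_UN ballI)
    ultimately show ?thesis by metis
  qed
  ultimately show ?thesis
    unfolding istopology_def by (intro conjI allI impI ballI) (blast, blast, blast, metis)
qed

lemma openin_cotangent_topology:
  "openin (cotangent_topology M A) W \<longleftrightarrow> W \<subseteq> cotangent_bundle M A \<and>
     (\<forall>c\<in>A. open ((cran c \<times> UNIV) \<inter> cot_inv M A c -` W))"
  by (simp add: cotangent_topology_def topology_inverse'[OF istopology_cotangent])

lemma chart_inj_on: "is_chart M c \<Longrightarrow> inj_on (cmap c) (cdom c)"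
  unfolding is_chart_def
  by (metis homeomorphic_imp_injective_map openin_subset topspace_subtopology_subset)

lemma open_chart_image:
  assumes "is_chart M c" "openin M V"
  shows "open (cmap c ` (V \<inter> cdom c))"
proof -
  have "openin (subtopology M (cdom c)) (V \<inter> cdom c)"
    using assms(2) by (simp add: openin_subtopology_Int)
  then have "openin (top_of_set (cran c)) (cmap c ` (V \<inter> cdom c))"
    using assms(1) homeomorphic_imp_open_map open_map_def unfolding is_chart_def by blast
  then show ?thesis
    using assms(1) openin_open_trans unfolding is_chart_def by blast
qed

lemma transition_differentiable:
  assumes "smooth_atlas M A" "c \<in> A" "c' \<in> A" "q \<in> cdom c" "q \<in> cdom c'"
  shows "transition c c' differentiable (at (cmap c q))"
proof -
  have "Cn_on 1 (cmap c ` (cdom c \<inter> cdom c')) (transition c c')"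
    using assms unfolding smooth_atlas_def Cr_on_def by (metis enat_ord_simps(3))
  then show ?thesis using assms by simp
qed

lemma bij_betw_cot_chart:
  assumes at: "smooth_atlas M A" and c: "c \<in> A"
  shows "bij_betw (cot_chart c) (cot_dom M A c) (cran c \<times> UNIV)"
proof (rule bij_betwI')
  fix z w assume z: "z \<in> cot_dom M A c" and w: "w \<in> cot_dom M A c"
  have inj: "inj_on (cmap c) (cdom c)" using at c chart_inj_on unfolding smooth_atlas_def by blast
  show "(cot_chart c z = cot_chart c w) = (z = w)"
  proof
    assume eq: "cot_chart c z = cot_chart c w"
    then have q: "fst z = fst w"
      using z w inj by (auto simp: cot_chart_def cot_dom_def inj_on_def)
    have e: "snd z c = snd w c" using eq by (simp add: cot_chart_def)
    have ct: "snd z \<in> cotangent_space A (fst z)" "snd w \<in> cotangent_space A (fst z)"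
      "fst z \<in> cdom c"
      using z w q by (auto simp: cot_dom_def cotangent_bundle_def)
    have "snd z c' = snd w c'" for c'
    proof (cases "c' \<in> A \<and> fst z \<in> cdom c'")
      case True
      have "p c' \<bullet> v = p c \<bullet> frechet_derivative (transition c' c) (at (cmap c' (fst z))) v"
        if "p \<in> cotangent_space A (fst z)" for p v
        using that True ct(3) c unfolding cotangent_space_def by blast
      then have "snd z c' \<bullet> v = snd w c' \<bullet> v" for v
        by (metis ct(1) ct(2) e)
      then show ?thesis using vector_eq_rdot by blast
    next
      case False
      then have "p c' = 0" if "p \<in> cotangent_space A (fst z)" for p
        using that unfolding cotangent_space_def by blast
      then show ?thesis using ct by metis
    qed
    then show "z = w" using q by (auto simp: prod_eq_iff)
  qed simp
next
  fix z assume "z \<in> cot_dom M A c"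
  then show "cot_chart c z \<in> cran c \<times> UNIV" by (auto simp: cot_chart_def cot_dom_def)
next
  fix y assume "y \<in> cran c \<times> (UNIV :: (real ^ 'b) set)"
  then obtain q \<xi> where y: "y = (cmap c q, \<xi>)" and q: "q \<in> cdom c" by auto
  let ?D = "\<lambda>c1 c2. frechet_derivative (transition c1 c2) (at (cmap c1 q))"
  have lin: "linear (?D c1 c2)" if "c1 \<in> A" "c2 \<in> A" "q \<in> cdom c1" "q \<in> cdom c2" for c1 c2
    using linear_frechet_derivative transition_differentiable[OF at] that by blast
  have inj: "inj_on (cmap c1) (cdom c1)" if "c1 \<in> A" for c1
    using at that chart_inj_on unfolding smooth_atlas_def by blast
  have ci: "cinv c1 (cmap c1 x) = x" if "c1 \<in> A" "x \<in> cdom c1" for c1 x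
    using inj that by (simp add: cinv_def)
  define p where "p = (\<lambda>c'. if c' \<in> A \<and> q \<in> cdom c' then adjoint (?D c' c) \<xi> else 0)"
  have pv: "p c' \<bullet> v = \<xi> \<bullet> ?D c' c v" if "c' \<in> A" "q \<in> cdom c'" for c' v
    using that adjoint_works[OF lin[OF that(1) c that(2) q], of v \<xi>]
    by (simp add: p_def inner_commute)
  have chain: "?D c1 c v = ?D c2 c (?D c1 c2 v)"
    if h: "c1 \<in> A" "c2 \<in> A" "q \<in> cdom c1" "q \<in> cdom c2" for c1 c2 v
  proof -
    have tr: "transition c1 c2 (cmap c1 q) = cmap c2 q" using ci h by (simp add: transition_def)
    have d1: "transition c1 c2 differentiable (at (cmap c1 q))"
      using transition_differentiable[OF at] h by blast
    have d2: "transition c2 c differentiable (at (transition c1 c2 (cmap c1 q)))"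
      using transition_differentiable[OF at] h c q by (simp add: tr)
    have d3: "transition c1 c differentiable (at (cmap c1 q))"
      using transition_differentiable[OF at] h c q by blast
    have op: "open (cmap c1 ` (cdom c2 \<inter> cdom c1))"
      using open_chart_image at h unfolding smooth_atlas_def is_chart_def by blast
    have "frechet_derivative (transition c1 c) (at (cmap c1 q)) =
        frechet_derivative (transition c2 c \<circ> transition c1 c2) (at (cmap c1 q))"
      by (rule frechet_derivative_transform_within_open[OF d3 op])
        (use h(3,4) ci[OF h(1)] ci[OF h(2)] in \<open>auto simp: transition_def\<close>)
    also have "\<dots> = ?D c2 c \<circ> ?D c1 c2"
      using frechet_derivative_compose[OF d1 d2] by (simp add: tr)
    finally show ?thesis by simp
  qed
  have "p \<in> cotangent_space A q"
    unfolding cotangent_space_def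
  proof (intro CollectI conjI allI ballI impI)
    fix c1 c2 v assume h: "c1 \<in> A" "c2 \<in> A" "q \<in> cdom c1" "q \<in> cdom c2"
    show "p c1 \<bullet> v = p c2 \<bullet> ?D c1 c2 v"
      unfolding pv[OF h(1,3)] pv[OF h(2,4)] chain[OF h] ..
  next
    fix c' assume "\<not> (c' \<in> A \<and> q \<in> cdom c')"
    then show "p c' = 0" unfolding p_def by (rule if_not_P)
  qed
  moreover have "p c = \<xi>"
  proof -
    have "frechet_derivative (transition c c) (at (cmap c q)) = frechet_derivative (\<lambda>x. x) (at (cmap c q))"
      by (rule frechet_derivative_transform_within_open[OF transition_differentiable[OF at c c q q], of "cran c"])
        (use at c q ci[OF c] in \<open>auto simp: transition_def smooth_atlas_def is_chart_def\<close>)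
    then have "p c \<bullet> v = \<xi> \<bullet> v" for v using pv[OF c q] by simp
    then show ?thesis using vector_eq_rdot by blast
  qed
  moreover have "q \<in> topspace M" using at c q unfolding smooth_atlas_def by blast
  ultimately show "\<exists>z\<in>cot_dom M A c. y = cot_chart c z"
    using q y by (intro bexI[of _ "(q, p)"]) (auto simp: cot_chart_def cot_dom_def cotangent_bundle_def)
qed

end

theory Submission
  imports Defs
begin

text \<open>Differentiating \<open>h(q) = H(q, \<Gamma>(q))\<close> and inserting Hamilton's equations for an integral curve
  that runs inside the graph of \<open>\<Gamma>\<close>, the symmetry of the derivative of the closed form \<open>\<Gamma>\<close> makes
  every point below \<open>\<Lambda>\<close> a critical point of \<open>h\<close>. By the Morse-Sard theorem for real functions of
  class \<open>C\<^bsup>d-1,1\<^esup>\<close> on a \<open>d\<close>-dimensional manifold (Bates), \<open>H ` \<Lambda>\<close> is then a null set; being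
  connected, it is a point.

  The Sard theorem follows Morse's argument. Near a point where some function vanishing on the
  critical set \<open>A\<close> has a nonzero derivative, the zero set of this function is straightened into a
  coordinate hyperplane, which lowers the dimension; at all other points of \<open>A\<close> the first
  derivatives of these functions vanish on the rest of \<open>A\<close> too, which lowers the smoothness needed.
  In the end \<open>\<bar>h x - h y\<bar> \<le> C \<bar>x - y\<bar>\<^sup>d\<close> holds on countably many pieces of \<open>A\<close>. For \<open>d \<ge> 2\<close>, such a
  piece has a null image: in a cube that it fills densely, a chain of \<open>N\<close> steps between two of its
  points improves the estimate by the factor \<open>N\<^bsup>1-d\<^esup>\<close>, and the cubes that it does not fill have
  small total volume. For \<open>d = 1\<close>, the bound \<open>o(\<bar>x - y\<bar>)\<close> at critical points suffices.\<close>

section \<open>Functions of high Hoelder order have null images\<close>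

text \<open>At the borderline class C^{d-1,1} the top derivatives are merely Lipschitz, so a piece
  of the critical set only admits the bound O(|x - y|^d). This makes the measure of the image
  finite, not zero; the chain of \<open>N\<close> steps supplies the missing gain. The second
  obstacle is a loss of smoothness: straightening a function of class C^{n,1} is a coordinate change
  of class C^{n,1} only, and a smoother function composed with it may become rougher. The induction
  therefore does not follow the smoothness of the function whose values are studied, but a family
  \<open>F\<close> that vanishes on the critical set and controls its increments. The count is as
  follows: \<open>F\<close> starts as the partial derivatives of h with \<open>n = d - 2\<close>,
  and order n+1 of \<open>F\<close> along a curve integrates to order d of h. Differentiating
  \<open>F\<close> lowers \<open>n\<close>, straightening lowers the number of free coordinates,
  while the exponent d and the ambient space never change.\<close>

lemma negligible_image_oscillation:
  fixes u :: "'a \<Rightarrow> real"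
  assumes "\<And>e. e > 0 \<Longrightarrow> \<exists>\<D> w. countable \<D> \<and> A \<subseteq> \<Union>\<D> \<and> (\<forall>K\<in>\<D>. \<forall>x\<in>A\<inter>K. \<forall>y\<in>A\<inter>K. \<bar>u x - u y\<bar> \<le> w K) \<and>
     (\<forall>K\<in>\<D>. 0 \<le> w K) \<and> (\<forall>\<F>. finite \<F> \<longrightarrow> \<F> \<subseteq> \<D> \<longrightarrow> sum w \<F> \<le> e)"
  shows "negligible (u ` A)"
  unfolding negligible_outer_le
proof (intro allI impI)
  fix e :: real assume "e > 0"
  \<comment> \<open>\<open>w K\<close> bounds the distance to one fixed value, so the interval that
    it defines has length \<open>2 * w K\<close>; half of \<open>e\<close> is the budget for the sum
    of the \<open>w K\<close>.\<close>
  then have "e/2 > 0" by simp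
  from assms[OF this] obtain \<D> w where "countable \<D> \<and> A \<subseteq> \<Union>\<D> \<and> (\<forall>K\<in>\<D>. \<forall>x\<in>A\<inter>K. \<forall>y\<in>A\<inter>K. \<bar>u x - u y\<bar> \<le> w K) \<and>
     (\<forall>K\<in>\<D>. 0 \<le> w K) \<and> (\<forall>\<F>. finite \<F> \<longrightarrow> \<F> \<subseteq> \<D> \<longrightarrow> sum w \<F> \<le> e/2)"
    by (elim exE)
  then have D: "countable \<D>" "A \<subseteq> \<Union>\<D>"
    and osc: "\<And>K x y. K \<in> \<D> \<Longrightarrow> x \<in> A\<inter>K \<Longrightarrow> y \<in> A\<inter>K \<Longrightarrow> \<bar>u x - u y\<bar> \<le> w K"
    and w0: "\<And>K. K\<in>\<D> \<Longrightarrow> 0 \<le> w K" and sw: "\<And>\<F>. finite \<F> \<Longrightarrow> \<F> \<subseteq> \<D> \<Longrightarrow> sum w \<F> \<le> e/2"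
    by blast+
  have "\<exists>c. u ` (A \<inter> K) \<subseteq> {c - w K..c + w K}" if "K \<in> \<D>" for K
  proof (cases "A \<inter> K = {}")
    case False
    then obtain x where x: "x \<in> A \<inter> K" by blast
    have "u ` (A \<inter> K) \<subseteq> {u x - w K..u x + w K}"
      using osc[OF that x] by (force simp: abs_le_iff)
    then show ?thesis by blast
  qed auto
  then obtain c where c: "\<And>K. K \<in> \<D> \<Longrightarrow> u ` (A \<inter> K) \<subseteq> {c K - w K..c K + w K}" by metis
  let ?g = "\<lambda>K. {c K - w K..c K + w K}"
  have m: "?g K \<in> lmeasurable" for K by simp
  have le: "measure lebesgue (\<Union>K\<in>\<F>. ?g K) \<le> e" if "\<F> \<subseteq> \<D>" "finite \<F>" for \<F>
  proof -
    have "measure lebesgue (\<Union>K\<in>\<F>. ?g K) \<le> (\<Sum>K\<in>\<F>. measure lebesgue (?g K))"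
      by (intro measure_UNION_le that) auto
    also have "\<dots> = (\<Sum>K\<in>\<F>. 2 * w K)"
      using w0 that by (intro sum.cong) auto
    also have "\<dots> \<le> e" using sw[OF that(2,1)] by (simp add: sum_distrib_left[symmetric])
    finally show ?thesis .
  qed
  show "\<exists>T. u ` A \<subseteq> T \<and> T \<in> lmeasurable \<and> measure lebesgue T \<le> e"
  proof (intro exI conjI)
    show "u ` A \<subseteq> (\<Union>K\<in>\<D>. ?g K)" using D(2) c by blast
    show "(\<Union>K\<in>\<D>. ?g K) \<in> lmeasurable"
      by (rule fmeasurable_UN_bound[OF D(1) m le])
    show "measure lebesgue (\<Union>K\<in>\<D>. ?g K) \<le> e"
      by (rule measure_UN_bound[OF D(1) m le])
  qed
qed

text \<open>Dyadic subdivision of one large cube keeps all sides of each \<open>K\<close> equal, so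
  a power of the diameter is comparable with the volume: the diagonal is at most the sum of
  \<open>DIM('a)\<close> equal sides, whence the factor \<open>DIM('a) ^ DIM('a)\<close>. The gauge
  makes every \<open>K\<close> small relative to a tag in \<open>A\<close>.\<close>

lemma covering_cubes:
  fixes A :: "'a::euclidean_space set"
  assumes "bounded A" "open T" "A \<subseteq> T" "\<And>x. x \<in> A \<Longrightarrow> 0 < \<delta> x"
  obtains \<D> where "countable \<D>" "A \<subseteq> \<Union>\<D>"
    "\<And>K. K \<in> \<D> \<Longrightarrow> \<exists>a b. K = cbox a b \<and> K \<noteq> {} \<and> norm (b - a) ^ DIM('a) \<le> real DIM('a) ^ DIM('a) * measure lebesgue K"
    "\<And>K. K \<in> \<D> \<Longrightarrow> K \<subseteq> T \<and> (\<exists>x\<in>A \<inter> K. K \<subseteq> ball x (\<delta> x))"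
    "pairwise (\<lambda>K L. negligible (K \<inter> L)) \<D>"
proof -
  obtain r where r: "r > 0" "\<And>x. x \<in> A \<Longrightarrow> norm x \<le> r"
    using assms(1) bounded_pos by blast
  let ?b = "r *\<^sub>R (\<Sum>i\<in>Basis. i) :: 'a"
  have bi: "?b \<bullet> i = r" if "i \<in> Basis" for i using that by (simp add: inner_sum_left_Basis)
  have sub: "A \<subseteq> cbox (-?b) ?b"
  proof
    fix x assume x: "x \<in> A"
    have "- r \<le> x \<bullet> i \<and> x \<bullet> i \<le> r" if "i \<in> Basis" for i
      using Basis_le_norm[OF that, of x] r(2)[OF x] by linarith
    then show "x \<in> cbox (-?b) ?b" using bi by (simp add: mem_box)
  qed
  have ne: "box (-?b) ?b \<noteq> {}"
    using r(1) bi by (simp add: box_ne_empty)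
  have "\<exists>e>0. ball x e \<subseteq> T" if "x \<in> A" for x
    using assms(2,3) that openE by blast
  then obtain e where e: "\<And>x. x \<in> A \<Longrightarrow> e x > 0 \<and> ball x (e x) \<subseteq> T" by metis
  \<comment> \<open>A gauge must be defined everywhere; off \<open>A\<close> its value is arbitrary
    because the tags lie in \<open>A\<close>. On \<open>A\<close> it encodes both
    \<open>K \<subseteq> T\<close> and \<open>K \<subseteq> ball x (\<delta> x)\<close>.\<close>
  define g where "g x = (if x \<in> A then ball x (min (e x) (\<delta> x)) else ball x 1)" for x
  have ga: "gauge g" using e assms(4) by (auto simp: gauge_def g_def)
  obtain \<D> where D: "countable \<D>" 
      and cbox: "\<And>K. K \<in> \<D> \<Longrightarrow> interior K \<noteq> {} \<and> (\<exists>u v. K = cbox u v)"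
      and dj: "pairwise (\<lambda>A B. interior A \<inter> interior B = {}) \<D>"
      and cov: "\<And>K. K \<in> \<D> \<Longrightarrow> \<exists>x \<in> A \<inter> K. K \<subseteq> g x"
      and close: "\<And>u v. cbox u v \<in> \<D> \<Longrightarrow> \<exists>n. \<forall>i \<in> Basis. v \<bullet> i - u \<bullet> i = (?b \<bullet> i - (-?b) \<bullet> i) / 2^n"
      and covers: "A \<subseteq> \<Union>\<D>"
    by (rule covering_lemma[OF sub ne ga]) blast
  show ?thesis
  proof (rule that[OF D covers])
    fix K assume K: "K \<in> \<D>"
    obtain u v where uv: "K = cbox u v" using cbox K by blast
    have Kne: "K \<noteq> {}" using cbox K by force
    obtain n where n: "\<And>i. i \<in> Basis \<Longrightarrow> v \<bullet> i - u \<bullet> i = (?b \<bullet> i - (-?b) \<bullet> i) / 2^n"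
      using close K uv by blast
    then have n: "v \<bullet> i - u \<bullet> i = 2 * r / 2^n" if "i \<in> Basis" for i
      using bi that by simp
    have "norm (v - u) \<le> (\<Sum>i\<in>Basis. \<bar>(v - u) \<bullet> i\<bar>)" by (rule norm_le_l1)
    also have "\<dots> = real DIM('a) * (2 * r / 2^n)" using r(1) n by (simp add: inner_diff_left)
    finally have "norm (v - u) ^ DIM('a) \<le> (real DIM('a) * (2 * r / 2^n)) ^ DIM('a)"
      by (intro power_mono) auto
    also have "\<dots> = real DIM('a) ^ DIM('a) * (\<Prod>i\<in>Basis. v \<bullet> i - u \<bullet> i)"
      using n by (simp add: power_mult_distrib[symmetric])
    also have "(\<Prod>i\<in>Basis. v \<bullet> i - u \<bullet> i) = measure lebesgue K"
      using Kne content_cbox'[of u v] by (simp add: uv)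
    finally show "\<exists>a b. K = cbox a b \<and> K \<noteq> {} \<and> norm (b - a) ^ DIM('a) \<le> real DIM('a) ^ DIM('a) * measure lebesgue K"
      using uv Kne by blast
  next
    fix K assume "K \<in> \<D>"
    then obtain x where "x \<in> A \<inter> K" "K \<subseteq> g x" using cov by blast
    then show "K \<subseteq> T \<and> (\<exists>x\<in>A \<inter> K. K \<subseteq> ball x (\<delta> x))"
      using e by (auto simp: g_def subset_eq)
  next
    show "pairwise (\<lambda>K L. negligible (K \<inter> L)) \<D>"
    proof (rule pairwiseI)
      fix K L assume h: "K \<in> \<D>" "L \<in> \<D>" "K \<noteq> L"
      then have "interior K \<inter> interior L = {}" using pairwiseD[OF dj h] by simp
      moreover obtain u v where "K = cbox u v" using cbox h(1) by blast
      moreover obtain x y where "L = cbox x y" using cbox h(2) by blast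
      ultimately show "negligible (K \<inter> L)"
        by (simp add: Int_interval box_Int_box negligible_interval(1))
    qed
  qed
qed

lemma sum_measure_Int_le:
  fixes X :: "'a::euclidean_space set"
  assumes "finite \<F>" "pairwise (\<lambda>K L. negligible (K \<inter> L)) \<F>" "\<And>K. K \<in> \<F> \<Longrightarrow> K \<in> lmeasurable"
    "X \<in> lmeasurable"
  shows "(\<Sum>K\<in>\<F>. measure lebesgue (K \<inter> X)) \<le> measure lebesgue X"
proof -
  have "(\<Sum>K\<in>\<F>. measure lebesgue (K \<inter> X)) = measure lebesgue (\<Union>K\<in>\<F>. K \<inter> X)"
  proof (rule measure_negligible_finite_Union_image[symmetric])
    show "pairwise (\<lambda>K L. negligible (K \<inter> X \<inter> (L \<inter> X))) \<F>"
      using assms(2) by (auto simp: pairwise_def intro: negligible_subset)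
  qed (use assms in \<open>auto intro: fmeasurable.Int\<close>)
  also have "\<dots> \<le> measure lebesgue X"
    using assms by (intro measure_mono_fmeasurable) (auto intro!: fmeasurableD fmeasurable.Int fmeasurable.finite_UN)
  finally show ?thesis .
qed

lemma norm_diff_le_cbox_diagonal:
  fixes a :: "'a::euclidean_space"
  assumes "s \<in> cbox a b" "t \<in> cbox a b"
  shows "norm (s - t) \<le> norm (b - a)"
proof (rule norm_le_componentwise)
  fix i :: 'a assume "i \<in> Basis"
  then show "\<bar>(s - t) \<bullet> i\<bar> \<le> \<bar>(b - a) \<bullet> i\<bar>"
    using assms by (force simp: mem_box inner_diff_left abs_if)
qed

text \<open>The points dividing the segment from \<open>x\<close> to \<open>y\<close> into
  \<open>N\<close> equal parts stay in the convex set \<open>K\<close> and are moved by at most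
  \<open>\<rho>\<close> into \<open>A\<close>. Consecutive points of the resulting chain are at
  distance at most \<open>3 * \<rho>\<close>: one subdivision step and two displacements. With
  \<open>\<rho>\<close> proportional to \<open>1 / N\<close>, the sum of the \<open>N\<close> bounds
  decays like N^(1-D).\<close>

lemma chain_oscillation:
  fixes u :: "'a::euclidean_space \<Rightarrow> real"
  assumes K: "convex K" and N: "N > (0::nat)" and C: "C \<ge> 0"
    and dense: "\<And>z. z \<in> K \<Longrightarrow> \<exists>a\<in>A \<inter> K. norm (a - z) \<le> \<rho>"
    and xy: "x \<in> A \<inter> K" "y \<in> A \<inter> K" "norm (y - x) \<le> real N * \<rho>"
    and u: "\<And>x y. x \<in> A \<Longrightarrow> y \<in> A \<Longrightarrow> \<bar>u x - u y\<bar> \<le> C * norm (x - y) ^ D"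
  shows "\<bar>u x - u y\<bar> \<le> real N * (C * (3 * \<rho>) ^ D)"
proof -
  have r0: "\<rho> \<ge> 0" using xy(3) N by (smt (verit) norm_ge_zero mult_pos_neg of_nat_0_less_iff)
  define z where "z i = x + (real i / real N) *\<^sub>R (y - x)" for i
  have zK: "z i \<in> K" if "i \<le> N" for i
  proof -
    have "z i = (1 - real i / real N) *\<^sub>R x + (real i / real N) *\<^sub>R y"
      by (simp add: z_def algebra_simps)
    also have "\<dots> \<in> K"
      using that N xy by (intro convexD[OF K]) auto
    finally show ?thesis .
  qed
  have "\<exists>a. i \<le> N \<longrightarrow> a \<in> A \<and> norm (a - z i) \<le> \<rho>" for i
    using dense[OF zK] by blast
  then obtain g where g: "\<And>i. i \<le> N \<Longrightarrow> g i \<in> A \<and> norm (g i - z i) \<le> \<rho>" by metis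
  \<comment> \<open>The two ends of the chain are \<open>x\<close> and \<open>y\<close> themselves,
    so that the increments of \<open>u\<close> telescope to \<open>u x - u y\<close>.\<close>
  define a where "a i = (if i = 0 then x else if i = N then y else g i)" for i
  have a: "a i \<in> A" "norm (a i - z i) \<le> \<rho>" if "i \<le> N" for i
    using g[OF that] xy N r0 by (auto simp: a_def z_def)
  have step: "\<bar>u (a i) - u (a (Suc i))\<bar> \<le> C * (3 * \<rho>) ^ D" if "i < N" for i
  proof -
    have "z i - z (Suc i) = - (1 / real N) *\<^sub>R (y - x)"
      by (simp add: z_def add_divide_distrib scaleR_add_left algebra_simps)
    then have "norm (z i - z (Suc i)) = norm (y - x) / N" by simp
    also have "\<dots> \<le> \<rho>" using xy(3) N by (simp add: divide_le_eq mult.commute)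
    finally have "norm (z i - z (Suc i)) \<le> \<rho>" .
    moreover have "a i - a (Suc i) = (a i - z i) + (z i - z (Suc i)) - (a (Suc i) - z (Suc i))" by simp
    ultimately have "norm (a i - a (Suc i)) \<le> 3 * \<rho>"
      using a(2)[of i] a(2)[of "Suc i"] that
        norm_triangle_ineq4[of "(a i - z i) + (z i - z (Suc i))" "a (Suc i) - z (Suc i)"]
        norm_triangle_ineq[of "a i - z i" "z i - z (Suc i)"] by simp
    then have "C * norm (a i - a (Suc i)) ^ D \<le> C * (3 * \<rho>) ^ D"
      using C by (intro mult_left_mono power_mono) auto
    then show ?thesis using u[OF a(1)[of i] a(1)[of "Suc i"]] that by simp
  qed
  have "k \<le> N \<Longrightarrow> \<bar>u (a 0) - u (a k)\<bar> \<le> real k * (C * (3 * \<rho>) ^ D)" for k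
  proof (induction k)
    case (Suc k)
    then show ?case using step[of k] by (simp add: algebra_simps)
  qed simp
  from this[of N] show ?thesis using N by (simp add: a_def)
qed

text \<open>The fineness \<open>N\<close> is fixed first, then an open set \<open>T\<close> around
  \<open>A\<close> whose excess over \<open>A\<close> is small depending on \<open>N\<close>. Either
  \<open>A\<close> fills a cube up to the distance diameter/\<open>N\<close>, and the chain gains a
  factor \<open>1 / N\<close> over the volume, or the cube contains a hole of N^(-d) times its
  volume, which belongs to \<open>T - A\<close>. The two terms of \<open>w\<close> pay for the two
  kinds of cubes.\<close>

lemma negligible_image_Holder_DIM:
  fixes u :: "'a::euclidean_space \<Rightarrow> real"
  assumes dim: "DIM('a) \<ge> 2" and bA: "bounded A" and mA: "A \<in> sets lebesgue"
    and u: "\<And>x y. x \<in> A \<Longrightarrow> y \<in> A \<Longrightarrow> \<bar>u x - u y\<bar> \<le> C * norm (x - y) ^ DIM('a)"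
  shows "negligible (u ` A)"
proof (rule negligible_image_oscillation)
  fix e :: real assume e: "e > 0"
  let ?D = "DIM('a)" and ?\<mu> = "measure lebesgue :: 'a set \<Rightarrow> real"
  define C' where "C' = max C 0 + 1"
  define k where "k = real ?D ^ ?D"
  have C': "C' > 0" and k: "k > 0" by (auto simp: C'_def k_def)
  have u': "\<bar>u x - u y\<bar> \<le> C' * norm (x - y) ^ ?D" if "x \<in> A" "y \<in> A" for x y
  proof -
    have "C * norm (x - y) ^ ?D \<le> C' * norm (x - y) ^ ?D"
      by (intro mult_right_mono) (auto simp: C'_def)
    then show ?thesis using u[OF that] by linarith
  qed
  obtain r where r: "A \<subseteq> ball 0 r" using bA bounded_subset_ballD by blast
  define B where "B = ball (0::'a) r"
  have B: "open B" "B \<in> lmeasurable" "A \<subseteq> B" using r by (auto simp: B_def)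
  have Am: "A \<in> lmeasurable" using mA B bounded_set_imp_lmeasurable bA by blast
  \<comment> \<open>The chain estimate \<open>N * C' * (3 * \<rho>)^d\<close>, with
    \<open>\<rho>\<close> the diameter divided by \<open>N\<close> and the d-th power of the
    diameter at most \<open>k\<close> times the volume, is at most \<open>c / N\<close> times the
    volume.\<close>
  define c where "c = C' * 3 ^ ?D * k"
  have c: "c > 0" using C' k by (simp add: c_def)
  obtain N where N: "N > (0::nat)" "c * ?\<mu> B / real N \<le> e / 2"
  proof -
    obtain N where N: "real N > 2 * (c * ?\<mu> B) / e + 1" using reals_Archimedean2 by blast
    have "0 \<le> 2 * (c * ?\<mu> B) / e" using c e by simp
    then have "real N > 0" using N by linarith
    moreover have "2 * (c * ?\<mu> B) \<le> e * real N"
      using N e by (simp add: field_simps)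
    ultimately show ?thesis using that[of N] by (simp add: field_simps)
  qed
  define c2 where "c2 = C' * k * real N ^ ?D"
  have c2: "c2 > 0" using C' k N by (simp add: c2_def)
  \<comment> \<open>\<open>c2\<close> is the price per unit of excess volume in a cube with a hole,
    so this \<open>\<eta>\<close> makes all such cubes together cost at most
    \<open>e / 2\<close>.\<close>
  define \<eta> where "\<eta> = e / (2 * c2)"
  have \<eta>: "\<eta> > 0" using e c2 by (simp add: \<eta>_def)
  obtain T0 where T0: "open T0" "A \<subseteq> T0" "T0 - A \<in> lmeasurable" "emeasure lebesgue (T0 - A) < ennreal \<eta>"
    using sets_lebesgue_outer_open[OF mA \<eta>] by blast
  define T where "T = T0 \<inter> B"
  have T: "open T" "A \<subseteq> T" using T0 B by (auto simp: T_def)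
  have TA: "T - A \<in> lmeasurable"
  proof -
    have "T - A = (T0 - A) \<inter> B" by (auto simp: T_def)
    then show ?thesis using T0(3) B(2) by (metis fmeasurable.Int)
  qed
  have "?\<mu> (T0 - A) < \<eta>"
    using T0(3,4) \<eta> by (simp add: emeasure_eq_measure2 ennreal_less_iff)
  moreover have "?\<mu> (T - A) \<le> ?\<mu> (T0 - A)"
    using TA T0(3) by (intro measure_mono_fmeasurable) (auto simp: T_def)
  ultimately have muT: "?\<mu> (T - A) \<le> \<eta>" by linarith
  obtain \<D> where D: "countable \<D>" "A \<subseteq> \<Union>\<D>"
    and cube: "\<And>K. K \<in> \<D> \<Longrightarrow> \<exists>a b. K = cbox a b \<and> K \<noteq> {} \<and> norm (b - a) ^ ?D \<le> real ?D ^ ?D * ?\<mu> K"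
    and KT: "\<And>K. K \<in> \<D> \<Longrightarrow> K \<subseteq> T \<and> (\<exists>x\<in>A \<inter> K. K \<subseteq> ball x 1)"
    and pw: "pairwise (\<lambda>K L. negligible (K \<inter> L)) \<D>"
    using covering_cubes[OF bA T, of "\<lambda>_. 1"] by (metis zero_less_one)
  define w where "w K = c / real N * ?\<mu> (K \<inter> B) + c2 * ?\<mu> (K \<inter> (T - A))" for K
  have osc: "\<bar>u x - u y\<bar> \<le> w K" if K: "K \<in> \<D>" and xy: "x \<in> A \<inter> K" "y \<in> A \<inter> K" for K x y
  proof -
    obtain a b where ab: "K = cbox a b" "K \<noteq> {}" "norm (b - a) ^ ?D \<le> k * ?\<mu> K"
      using cube[OF K] unfolding k_def by blast
    have KB: "K \<inter> B = K" using KT[OF K] by (auto simp: T_def)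
    have diam: "norm (s - t) \<le> norm (b - a)" if "s \<in> K" "t \<in> K" for s t
      using that norm_diff_le_cbox_diagonal ab by blast
    define \<rho> where "\<rho> = norm (b - a) / real N"
    show ?thesis
    proof (cases "\<forall>z\<in>K. \<exists>p\<in>A \<inter> K. norm (p - z) \<le> \<rho>")
      case True
      have "\<bar>u x - u y\<bar> \<le> real N * (C' * (3 * \<rho>) ^ ?D)"
      proof (rule chain_oscillation[of K])
        show "norm (y - x) \<le> real N * \<rho>" using diam[of y x] xy N by (simp add: \<rho>_def)
      qed (use True N C' xy u' ab in auto)
      also have "\<dots> = C' * 3 ^ ?D * (norm (b - a) ^ ?D * (real N / real N ^ ?D))"
        by (simp add: \<rho>_def power_mult_distrib power_divide)
      also have "\<dots> \<le> C' * 3 ^ ?D * ((k * ?\<mu> K) * (1 / real N))"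
      proof (intro mult_left_mono mult_mono ab(3))
        \<comment> \<open>The gain rests on the dimension: because d is at least 2,
          \<open>N / N^d\<close> is at most \<open>1 / N\<close>.\<close>
        have "real N ^ 2 \<le> real N ^ ?D" using N dim by (intro power_increasing) auto
        then show "real N / real N ^ ?D \<le> 1 / real N"
          using N by (simp add: field_simps power2_eq_square)
      qed (use C' k in auto)
      also have "\<dots> = c / real N * ?\<mu> (K \<inter> B)" by (simp add: c_def KB)
      also have "\<dots> \<le> w K" using c2 by (simp add: w_def)
      finally show ?thesis .
    next
      case False
      then obtain z where z: "z \<in> K" and nz: "\<And>p. p \<in> A \<inter> K \<Longrightarrow> norm (p - z) > \<rho>"
        by (meson not_le)
      define t where "t = 1 / real N"
      have t: "t > 0" "t \<le> 1" using N by (auto simp: t_def)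
      \<comment> \<open>The hole: the image of \<open>K\<close> under the homothety with centre
        \<open>z\<close> and ratio \<open>1 / N\<close>. Convexity keeps it in \<open>K\<close>, and
        its points are within \<open>\<rho>\<close> of \<open>z\<close>, so none of them belongs to
        \<open>A\<close>.\<close>
      define K' where "K' = cbox ((1 - t) *\<^sub>R z + t *\<^sub>R a) ((1 - t) *\<^sub>R z + t *\<^sub>R b)"
      have ab_le: "a \<bullet> i \<le> b \<bullet> i" "a \<bullet> i \<le> z \<bullet> i" "z \<bullet> i \<le> b \<bullet> i" if "i \<in> Basis" for i
        using z that by (auto simp: ab(1) mem_box intro: order_trans)
      have K'im: "K' \<subseteq> (\<lambda>v. (1 - t) *\<^sub>R z + t *\<^sub>R v) ` K"
      proof
        fix p assume p: "p \<in> K'"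
        let ?v = "(1 / t) *\<^sub>R (p - (1 - t) *\<^sub>R z)"
        have "a \<bullet> i \<le> ?v \<bullet> i \<and> ?v \<bullet> i \<le> b \<bullet> i" if "i \<in> Basis" for i
        proof -
          have "(1 - t) * (z \<bullet> i) + t * (a \<bullet> i) \<le> p \<bullet> i \<and> p \<bullet> i \<le> (1 - t) * (z \<bullet> i) + t * (b \<bullet> i)"
            using p that by (simp add: K'_def mem_box inner_simps)
          then have "a \<bullet> i * t \<le> p \<bullet> i - (1 - t) * (z \<bullet> i) \<and> p \<bullet> i - (1 - t) * (z \<bullet> i) \<le> b \<bullet> i * t"
            by (simp add: mult.commute)
          moreover have "?v \<bullet> i = (p \<bullet> i - (1 - t) * (z \<bullet> i)) / t" by (simp add: inner_simps)
          ultimately show ?thesis using t by (simp add: le_divide_eq divide_le_eq)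
        qed
        then have "?v \<in> K" by (simp add: ab(1) mem_box)
        moreover have "p = (1 - t) *\<^sub>R z + t *\<^sub>R ?v" using t by (simp add: algebra_simps)
        ultimately show "p \<in> (\<lambda>v. (1 - t) *\<^sub>R z + t *\<^sub>R v) ` K" by blast
      qed
      have K'K: "K' \<subseteq> K"
      proof -
        have "(1 - t) *\<^sub>R z + t *\<^sub>R v \<in> K" if "v \<in> K" for v
          using convexD[of K z v "1 - t" t] that z t ab(1) by auto
        then show ?thesis using K'im by blast
      qed
      have "p \<notin> A" if pK: "p \<in> K'" for p
      proof
        assume pA: "p \<in> A"
        obtain v where v: "v \<in> K" "p = (1 - t) *\<^sub>R z + t *\<^sub>R v" using K'im pK by blast
        have "p - z = t *\<^sub>R (v - z)" by (simp add: v(2) algebra_simps)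
        then have "norm (p - z) = t * norm (v - z)" using t by simp
        also have "\<dots> \<le> t * norm (b - a)" using diam[OF v(1) z] t by simp
        also have "\<dots> = \<rho>" by (simp add: t_def \<rho>_def)
        finally show False using nz[of p] pA K'K pK by auto
      qed
      then have sub: "K' \<subseteq> K \<inter> (T - A)" using K'K KT[OF K] by blast
      have "?\<mu> K' = (\<Prod>i\<in>Basis. t * (b \<bullet> i - a \<bullet> i))"
      proof -
        have "?\<mu> K' = (\<Prod>i\<in>Basis. ((1 - t) *\<^sub>R z + t *\<^sub>R b) \<bullet> i - ((1 - t) *\<^sub>R z + t *\<^sub>R a) \<bullet> i)"
          unfolding K'_def using ab_le t by (simp add: content_cbox inner_simps)
        also have "\<dots> = (\<Prod>i\<in>Basis. t * (b \<bullet> i - a \<bullet> i))"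
          by (intro prod.cong) (auto simp: inner_simps algebra_simps)
        finally show ?thesis .
      qed
      also have "\<dots> = t ^ ?D * ?\<mu> K"
        using ab_le by (simp add: ab(1) prod.distrib content_cbox inner_diff_left)
      finally have muK: "?\<mu> K = real N ^ ?D * ?\<mu> K'" using N by (simp add: t_def field_simps)
      have "?\<mu> K' \<le> ?\<mu> (K \<inter> (T - A))"
        using sub TA by (intro measure_mono_fmeasurable) (auto simp: K'_def ab(1) intro: fmeasurable.Int)
      then have "?\<mu> K \<le> real N ^ ?D * ?\<mu> (K \<inter> (T - A))"
        unfolding muK by (intro mult_left_mono) auto
      then have "C' * (k * ?\<mu> K) \<le> C' * (k * (real N ^ ?D * ?\<mu> (K \<inter> (T - A))))"
        using C' k by (intro mult_left_mono) auto
      moreover have "\<bar>u x - u y\<bar> \<le> C' * norm (b - a) ^ ?D"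
        using u'[of x y] xy diam[of x y] C' 
        by (smt (verit, best) IntD1 IntD2 mult_left_mono norm_ge_zero power_mono)
      moreover have "C' * norm (b - a) ^ ?D \<le> C' * (k * ?\<mu> K)"
        using ab(3) C' by (intro mult_left_mono) auto
      moreover have "c2 * ?\<mu> (K \<inter> (T - A)) \<le> w K" using c by (simp add: w_def)
      ultimately show ?thesis by (simp add: c2_def mult.assoc)
    qed
  qed
  have "sum w \<F> \<le> e" if "finite \<F>" "\<F> \<subseteq> \<D>" for \<F>
  proof -
    have Km: "K \<in> lmeasurable" if "K \<in> \<F>" for K
      using cube[of K] that \<open>\<F> \<subseteq> \<D>\<close> by auto
    have pwF: "pairwise (\<lambda>K L. negligible (K \<inter> L)) \<F>" using pw that pairwise_subset by blast
    have "sum w \<F> = c / real N * (\<Sum>K\<in>\<F>. ?\<mu> (K \<inter> B)) + c2 * (\<Sum>K\<in>\<F>. ?\<mu> (K \<inter> (T - A)))"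
      by (simp add: w_def sum.distrib sum_distrib_left)
    also have "\<dots> \<le> c / real N * ?\<mu> B + c2 * ?\<mu> (T - A)"
      using sum_measure_Int_le[OF that(1) pwF Km B(2)] sum_measure_Int_le[OF that(1) pwF Km TA] c c2
      by (intro add_mono mult_left_mono) auto
    also have "\<dots> \<le> e / 2 + c2 * \<eta>"
      using N(2) muT c2 by (intro add_mono mult_left_mono) auto
    also have "\<dots> = e" using c2 by (simp add: \<eta>_def)
    finally show ?thesis .
  qed
  moreover have "0 \<le> w K" for K using c c2 by (simp add: w_def)
  ultimately show "\<exists>\<D> w. countable \<D> \<and> A \<subseteq> \<Union>\<D> \<and> (\<forall>K\<in>\<D>. \<forall>x\<in>A\<inter>K. \<forall>y\<in>A\<inter>K. \<bar>u x - u y\<bar> \<le> w K) \<and>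
     (\<forall>K\<in>\<D>. 0 \<le> w K) \<and> (\<forall>\<F>. finite \<F> \<longrightarrow> \<F> \<subseteq> \<D> \<longrightarrow> sum w \<F> \<le> e)"
    using D osc by (intro exI[of _ \<D>] exI[of _ w] conjI ballI allI impI) auto
qed

text \<open>The radius that belongs to a given \<open>e\<close> may depend on the point, which is
  what a covering subordinate to a gauge allows. Two points of a cube are both compared with the tag
  of that cube, whence the factor 2 in \<open>w\<close>.\<close>

lemma negligible_image_little_o_DIM:
  fixes u :: "'a::euclidean_space \<Rightarrow> real"
  assumes bA: "bounded A"
    and u: "\<And>x e. x \<in> A \<Longrightarrow> e > 0 \<Longrightarrow> \<exists>\<delta>>0. \<forall>y\<in>A. norm (y - x) < \<delta> \<longrightarrow> \<bar>u y - u x\<bar> \<le> e * norm (y - x) ^ DIM('a)"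
  shows "negligible (u ` A)"
proof (rule negligible_image_oscillation)
  fix e :: real assume e: "e > 0"
  let ?D = "DIM('a)" and ?\<mu> = "measure lebesgue :: 'a set \<Rightarrow> real"
  define k where "k = real ?D ^ ?D"
  have k: "k > 0" by (auto simp: k_def)
  obtain r where r: "A \<subseteq> ball 0 r" using bA bounded_subset_ballD by blast
  define B where "B = ball (0::'a) r"
  have B: "open B" "B \<in> lmeasurable" "A \<subseteq> B" using r by (auto simp: B_def)
  \<comment> \<open>Adding 1 keeps the denominator positive even if \<open>B\<close> is
    empty.\<close>
  define \<epsilon> where "\<epsilon> = e / (2 * k * (?\<mu> B + 1))"
  have B1: "?\<mu> B + 1 > 0" by (smt (verit) measure_nonneg)
  have \<epsilon>: "\<epsilon> > 0" using e k B1 by (simp add: \<epsilon>_def)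
  obtain \<delta> where \<delta>: "\<And>x. x \<in> A \<Longrightarrow> \<delta> x > 0"
    "\<And>x y. x \<in> A \<Longrightarrow> y \<in> A \<Longrightarrow> norm (y - x) < \<delta> x \<Longrightarrow> \<bar>u y - u x\<bar> \<le> \<epsilon> * norm (y - x) ^ ?D"
    using u[OF _ \<epsilon>] by metis
  obtain \<D> where D: "countable \<D>" "A \<subseteq> \<Union>\<D>"
    and cube: "\<And>K. K \<in> \<D> \<Longrightarrow> \<exists>a b. K = cbox a b \<and> K \<noteq> {} \<and> norm (b - a) ^ ?D \<le> real ?D ^ ?D * ?\<mu> K"
    and KT: "\<And>K. K \<in> \<D> \<Longrightarrow> K \<subseteq> B \<and> (\<exists>x\<in>A \<inter> K. K \<subseteq> ball x (\<delta> x))"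
    and pw: "pairwise (\<lambda>K L. negligible (K \<inter> L)) \<D>"
    using covering_cubes[OF bA B(1,3), of \<delta>] \<delta>(1) by metis
  define w where "w K = 2 * \<epsilon> * k * ?\<mu> (K \<inter> B)" for K
  have osc: "\<bar>u x - u y\<bar> \<le> w K" if K: "K \<in> \<D>" and xy: "x \<in> A \<inter> K" "y \<in> A \<inter> K" for K x y
  proof -
    obtain a b where ab: "K = cbox a b" "K \<noteq> {}" "norm (b - a) ^ ?D \<le> k * ?\<mu> K"
      using cube[OF K] unfolding k_def by blast
    have KB: "K \<inter> B = K" using KT[OF K] by auto
    have diam: "norm (s - t) \<le> norm (b - a)" if "s \<in> K" "t \<in> K" for s t
      using that norm_diff_le_cbox_diagonal ab by blast
    obtain z where z: "z \<in> A \<inter> K" "K \<subseteq> ball z (\<delta> z)" using KT[OF K] by blast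
    have "\<bar>u v - u z\<bar> \<le> \<epsilon> * (k * ?\<mu> K)" if "v \<in> A \<inter> K" for v
    proof -
      have "norm (v - z) < \<delta> z" using z that by (auto simp: dist_norm norm_minus_commute)
      then have "\<bar>u v - u z\<bar> \<le> \<epsilon> * norm (v - z) ^ ?D" using \<delta>(2) z that by auto
      also have "\<dots> \<le> \<epsilon> * norm (b - a) ^ ?D"
        using \<epsilon> diam[of v z] z that by (intro mult_left_mono power_mono) auto
      also have "\<dots> \<le> \<epsilon> * (k * ?\<mu> K)" using \<epsilon> ab by (intro mult_left_mono) auto
      finally show ?thesis .
    qed
    from this[OF xy(1)] this[OF xy(2)] show ?thesis by (simp add: w_def KB)
  qed
  have "sum w \<F> \<le> e" if "finite \<F>" "\<F> \<subseteq> \<D>" for \<F>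
  proof -
    have Km: "K \<in> lmeasurable" if "K \<in> \<F>" for K
      using cube[of K] that \<open>\<F> \<subseteq> \<D>\<close> by auto
    have pwF: "pairwise (\<lambda>K L. negligible (K \<inter> L)) \<F>" using pw that pairwise_subset by blast
    have "sum w \<F> = 2 * \<epsilon> * k * (\<Sum>K\<in>\<F>. ?\<mu> (K \<inter> B))"
      by (simp add: w_def sum_distrib_left)
    also have "\<dots> \<le> 2 * \<epsilon> * k * (?\<mu> B + 1)"
      using sum_measure_Int_le[OF that(1) pwF Km B(2)] \<epsilon> k
      by (intro mult_left_mono) auto
    also have "\<dots> = e" using k B1 by (simp add: \<epsilon>_def)
    finally show ?thesis .
  qed
  moreover have "0 \<le> w K" for K using \<epsilon> k by (simp add: w_def)
  ultimately show "\<exists>\<D> w. countable \<D> \<and> A \<subseteq> \<Union>\<D> \<and> (\<forall>K\<in>\<D>. \<forall>x\<in>A\<inter>K. \<forall>y\<in>A\<inter>K. \<bar>u x - u y\<bar> \<le> w K) \<and>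
     (\<forall>K\<in>\<D>. 0 \<le> w K) \<and> (\<forall>\<F>. finite \<F> \<longrightarrow> \<F> \<subseteq> \<D> \<longrightarrow> sum w \<F> \<le> e)"
    using D osc by (intro exI[of _ \<D>] exI[of _ w] conjI ballI allI impI) auto
qed

section \<open>Calculus in the classes of functions with Lipschitz derivatives\<close>

lemma Cns_on_cong:
  assumes "open S" "\<And>x. x \<in> S \<Longrightarrow> f x = g x" "Cns_on n s S f"
  shows "Cns_on n s S g"
  using assms
proof (induction n arbitrary: f g)
  case 0
  then show ?case by (auto simp: locally_holder_on_def cong: continuous_on_cong)
next
  case (Suc n)
  have fg: "frechet_derivative f (at x) = frechet_derivative g (at x)" if "x \<in> S" for x
    using Suc.prems that by (intro frechet_derivative_transform_within_open[of f x S]) auto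
  have "g differentiable (at x)" if "x \<in> S" for x
    using Suc.prems that unfolding differentiable_def
    by (metis Cns_on.simps(2) differentiable_def has_derivative_transform_within_open)
  moreover have "Cns_on n s S (\<lambda>x. frechet_derivative g (at x) v)" for v
    by (rule Suc.IH[OF Suc.prems(1), of "\<lambda>x. frechet_derivative f (at x) v"])
      (use fg Suc.prems(3) in auto)
  ultimately show ?case by simp
qed

lemma Cns_on_subset:
  assumes "T \<subseteq> S" "Cns_on n s S f"
  shows "Cns_on n s T f"
  using assms
proof (induction n arbitrary: f)
  case 0
  have "locally_holder_on s T f"
    unfolding locally_holder_on_def
  proof
    fix x assume "x \<in> T"
    then obtain e C where "e > 0" "\<forall>y\<in>S \<inter> ball x e. \<forall>z\<in>S \<inter> ball x e. dist (f y) (f z) \<le> C * dist y z powr s"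
      using 0 unfolding Cns_on.simps locally_holder_on_def by blast
    then show "\<exists>e>0. \<exists>C. \<forall>y\<in>T \<inter> ball x e. \<forall>z\<in>T \<inter> ball x e. dist (f y) (f z) \<le> C * dist y z powr s"
      using 0(1) by (intro exI[of _ e] conjI exI[of _ C]) auto
  qed
  then show ?case using 0 continuous_on_subset by auto
qed auto

lemma Cns_on_Suc_I:
  assumes "open S" "\<And>x. x \<in> S \<Longrightarrow> (f has_derivative f' x) (at x)" "\<And>v. Cns_on n s S (\<lambda>x. f' x v)"
  shows "Cns_on (Suc n) s S f"
proof -
  have "Cns_on n s S (\<lambda>x. frechet_derivative f (at x) v)" for v
    by (rule Cns_on_cong[OF assms(1) _ assms(3)[of v]]) (metis assms(2) frechet_derivative_at)
  moreover have "f differentiable (at x)" if "x \<in> S" for x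
    using assms(2)[OF that] differentiable_def by blast
  ultimately show ?thesis by simp
qed

lemma Cns_on_Suc_has_derivative:
  assumes "Cns_on (Suc n) s S f" "x \<in> S"
  shows "(f has_derivative frechet_derivative f (at x)) (at x)"
  using assms frechet_derivative_works by auto

lemma Cns_on_continuous: "Cns_on n s S f \<Longrightarrow> continuous_on S f"
  by (cases n) (auto intro!: continuous_at_imp_continuous_on differentiable_imp_continuous_within)

text \<open>Continuity is given for each direction \<open>v\<close> separately. Near
  \<open>x\<close> the finitely many basis directions are bounded together, and linearity extends
  the bound to all \<open>v\<close>.\<close>

lemma locally_bounded_derivative:
  fixes f :: "'a::euclidean_space \<Rightarrow> 'b::real_normed_vector"
  assumes "open S" "\<And>x. x \<in> S \<Longrightarrow> (f has_derivative f' x) (at x)"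
    and cont: "\<And>v. continuous_on S (\<lambda>x. f' x v)" and x: "x \<in> S"
  obtains e C where "e > 0" "ball x e \<subseteq> S" "C \<ge> 0" "\<And>y v. y \<in> ball x e \<Longrightarrow> norm (f' y v) \<le> C * norm v"
proof -
  have "\<exists>e>0. ball x e \<subseteq> S \<and> (\<forall>y\<in>ball x e. norm (f' y b) \<le> norm (f' x b) + 1)" for b
  proof -
    have "isCont (\<lambda>y. f' y b) x" using cont assms(1) x continuous_on_eq_continuous_at by blast
    then have "isCont (\<lambda>y. norm (f' y b)) x" by (rule continuous_norm)
    then have "\<forall>\<^sub>F y in at x. norm (f' y b) < norm (f' x b) + 1"
      by (intro order_tendstoD(2)[of _ "norm (f' x b)"]) (auto simp: isCont_def)
    moreover have "\<forall>\<^sub>F y in at x. y \<in> S" using assms(1) x eventually_at_topological by blast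
    ultimately have "\<forall>\<^sub>F y in at x. y \<in> S \<and> norm (f' y b) < norm (f' x b) + 1"
      by (rule eventually_conj[rotated])
    then obtain e where e: "e > 0" "\<And>y. y \<noteq> x \<Longrightarrow> dist y x < e \<Longrightarrow> y \<in> S \<and> norm (f' y b) < norm (f' x b) + 1"
      by (auto simp: eventually_at)
    then show ?thesis
    proof (intro exI[of _ e] conjI)
      show "ball x e \<subseteq> S" using e x by (metis dist_commute mem_ball subsetI)
      show "\<forall>y\<in>ball x e. norm (f' y b) \<le> norm (f' x b) + 1"
      proof
        fix y assume "y \<in> ball x e"
        then show "norm (f' y b) \<le> norm (f' x b) + 1"
          using e(2)[of y] by (cases "y = x") (auto simp: dist_commute)
      qed
    qed
  qed
  then obtain e where e: "\<And>b. e b > 0" "\<And>b. ball x (e b) \<subseteq> S"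
    "\<And>b y. y \<in> ball x (e b) \<Longrightarrow> norm (f' y b) \<le> norm (f' x b) + 1" by metis
  define e0 where "e0 = Min (e ` Basis)"
  define C where "C = (\<Sum>b\<in>Basis. norm (f' x b) + 1)"
  have "e0 > 0" using e(1) by (auto simp: e0_def)
  have le: "e0 \<le> e b" if "b \<in> Basis" for b using that by (auto simp: e0_def)
  obtain b0 :: 'a where b0: "b0 \<in> Basis" using nonempty_Basis by blast
  show ?thesis
  proof (rule that[of e0 C])
    show "ball x e0 \<subseteq> S" using e(2)[of b0] le[OF b0] by auto
    show "C \<ge> 0" by (auto simp: C_def intro!: sum_nonneg add_nonneg_nonneg)
    fix y v assume y: "y \<in> ball x e0"
    then have "y \<in> S" using \<open>ball x e0 \<subseteq> S\<close> by blast
    then have bl: "bounded_linear (f' y)" using assms(2) has_derivative_bounded_linear by blast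
    interpret bounded_linear "f' y" by (rule bl)
    have "f' y v = f' y (\<Sum>b\<in>Basis. (v \<bullet> b) *\<^sub>R b)" by (simp add: euclidean_representation)
    also have "\<dots> = (\<Sum>b\<in>Basis. (v \<bullet> b) *\<^sub>R f' y b)" by (simp add: sum scaleR)
    finally have "norm (f' y v) \<le> (\<Sum>b\<in>Basis. norm ((v \<bullet> b) *\<^sub>R f' y b))"
      using norm_sum by metis
    also have "\<dots> \<le> (\<Sum>b\<in>Basis. norm v * (norm (f' x b) + 1))"
    proof (rule sum_mono)
      fix b :: 'a assume b: "b \<in> Basis"
      have "norm (f' y b) \<le> norm (f' x b) + 1" using e(3) le[OF b] y by auto
      then show "norm ((v \<bullet> b) *\<^sub>R f' y b) \<le> norm v * (norm (f' x b) + 1)"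
        using Basis_le_norm[OF b, of v] by (auto intro: mult_mono)
    qed
    also have "\<dots> = C * norm v" by (simp add: C_def sum_distrib_left mult.commute)
    finally show "norm (f' y v) \<le> C * norm v" .
  qed fact
qed

lemma C1_locally_lipschitz:
  fixes f :: "'a::euclidean_space \<Rightarrow> 'b::real_normed_vector"
  assumes "open S" "\<And>x. x \<in> S \<Longrightarrow> (f has_derivative f' x) (at x)"
    and "\<And>v. continuous_on S (\<lambda>x. f' x v)"
  shows "Cns_on 0 1 S f"
proof -
  have "continuous_on S f"
    using assms(2) by (intro continuous_at_imp_continuous_on ballI) (auto intro: has_derivative_continuous)
  moreover have "locally_holder_on 1 S f"
    unfolding locally_holder_on_def
  proof
    fix x assume "x \<in> S"
    then obtain e C where e: "e > 0" "ball x e \<subseteq> S" "C \<ge> 0" "\<And>y v. y \<in> ball x e \<Longrightarrow> norm (f' y v) \<le> C * norm v"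
      using locally_bounded_derivative[OF assms] by metis
    have "norm (f y - f z) \<le> C * norm (y - z)" if "y \<in> ball x e" "z \<in> ball x e" for y z
    proof (rule differentiable_bound[of "ball x e" f f'])
      fix w assume w: "w \<in> ball x e"
      show "(f has_derivative f' w) (at w within ball x e)"
        using assms(2) e(2) w has_derivative_at_withinI by blast
      show "onorm (f' w) \<le> C" using e(4)[OF w] by (intro onorm_le) auto
    qed (use that in auto)
    then show "\<exists>e>0. \<exists>C. \<forall>y\<in>S \<inter> ball x e. \<forall>z\<in>S \<inter> ball x e. dist (f y) (f z) \<le> C * dist y z powr 1"
      using e(1) by (intro exI[of _ e] conjI exI[of _ C]) (auto simp: dist_norm)
  qed
  ultimately show ?thesis by simp
qed

text \<open>One more derivative buys Lipschitz continuity whatever the exponent \<open>s\<close>, by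
  the mean value inequality on small balls. This reduces the case \<open>d' \<ge> d\<close> to the
  class C^{d-1,1}.\<close>

lemma Cns_on_pred:
  fixes f :: "'a::euclidean_space \<Rightarrow> 'b::real_normed_vector"
  assumes "open S" "Cns_on (Suc n) s S f"
  shows "Cns_on n 1 S f"
  using assms(2)
proof (induction n arbitrary: f)
  case 0
  show ?case
  proof (rule C1_locally_lipschitz[OF assms(1)])
    show "(f has_derivative frechet_derivative f (at x)) (at x)" if "x \<in> S" for x
      using Cns_on_Suc_has_derivative[OF 0 that] .
    show "continuous_on S (\<lambda>x. frechet_derivative f (at x) v)" for v
      using 0 by simp
  qed
qed auto

lemma Cns_on_1_antimono:
  fixes f :: "'a::euclidean_space \<Rightarrow> 'b::real_normed_vector"
  assumes "open S" "m \<le> n" "Cns_on n 1 S f"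
  shows "Cns_on m 1 S f"
  using assms(2)
proof (induction rule: inc_induct)
  case (step k)
  then show ?case using Cns_on_pred[OF assms(1)] by blast
qed (rule assms(3))

text \<open>For exponent 1 the local bound already implies continuity, and the constant may be
  enlarged to a nonnegative one, so that such bounds can be multiplied.\<close>

lemma Cns_on_0_iff_locally_lipschitz:
  "Cns_on 0 1 S f \<longleftrightarrow> (\<forall>x\<in>S. \<exists>e>0. \<exists>C\<ge>0. \<forall>y\<in>S \<inter> ball x e. \<forall>z\<in>S \<inter> ball x e. norm (f y - f z) \<le> C * norm (y - z))"
    (is "_ \<longleftrightarrow> ?R")
proof
  assume "Cns_on 0 1 S f"
  then have H: "locally_holder_on 1 S f" by simp
  show ?R
  proof
    fix x assume "x \<in> S"
    then obtain e C where eC: "e > 0" "\<forall>y\<in>S \<inter> ball x e. \<forall>z\<in>S \<inter> ball x e. dist (f y) (f z) \<le> C * dist y z"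
      using H by (auto simp: locally_holder_on_def)
    have "norm (f y - f z) \<le> max C 0 * norm (y - z)" if "y \<in> S \<inter> ball x e" "z \<in> S \<inter> ball x e" for y z
    proof -
      have "norm (f y - f z) \<le> C * norm (y - z)" using eC(2) that by (simp add: dist_norm)
      also have "\<dots> \<le> max C 0 * norm (y - z)" by (intro mult_right_mono) auto
      finally show ?thesis .
    qed
    then show "\<exists>e>0. \<exists>C\<ge>0. \<forall>y\<in>S \<inter> ball x e. \<forall>z\<in>S \<inter> ball x e. norm (f y - f z) \<le> C * norm (y - z)"
      using eC(1) by (intro exI[of _ e] conjI exI[of _ "max C 0"]) auto
  qed
next
  assume R: ?R
  have "locally_holder_on 1 S f"
    unfolding locally_holder_on_def
  proof
    fix x assume "x \<in> S"
    then obtain e C where "e > 0" "\<forall>y\<in>S \<inter> ball x e. \<forall>z\<in>S \<inter> ball x e. norm (f y - f z) \<le> C * norm (y - z)"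
      using R by blast
    then show "\<exists>e>0. \<exists>C. \<forall>y\<in>S \<inter> ball x e. \<forall>z\<in>S \<inter> ball x e. dist (f y) (f z) \<le> C * dist y z powr 1"
      by (intro exI[of _ e] conjI exI[of _ C]) (auto simp: dist_norm)
  qed
  moreover have "continuous_on S f"
    unfolding continuous_on_iff
  proof (intro ballI allI impI)
    fix x and \<epsilon> :: real assume x: "x \<in> S" and \<epsilon>: "\<epsilon> > 0"
    obtain e C where e: "e > 0" "C \<ge> 0" "\<forall>y\<in>S \<inter> ball x e. \<forall>z\<in>S \<inter> ball x e. norm (f y - f z) \<le> C * norm (y - z)"
      using R x by blast
    show "\<exists>d>0. \<forall>x'\<in>S. dist x' x < d \<longrightarrow> dist (f x') (f x) < \<epsilon>"
    proof (intro exI conjI ballI impI)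
      show "min e (\<epsilon> / (C + 1)) > 0" using e \<epsilon> by simp
      fix y assume y: "y \<in> S" "dist y x < min e (\<epsilon> / (C + 1))"
      then have "norm (f y - f x) \<le> C * norm (y - x)" using e(1,3) x by (auto simp: dist_commute)
      also have "\<dots> \<le> (C + 1) * norm (y - x)" by (intro mult_right_mono) auto
      also have "\<dots> < \<epsilon>" using y e(2) by (simp add: dist_norm less_divide_eq mult.commute)
      finally show "dist (f y) (f x) < \<epsilon>" by (simp add: dist_norm)
    qed
  qed
  ultimately show "Cns_on 0 1 S f" by simp
qed

section \<open>Closure properties of the classes C^{n,1}\<close>

lemma Cns_on_const: "open S \<Longrightarrow> Cns_on n 1 S (\<lambda>x. c)"
proof (induction n arbitrary: c)
  case 0
  show ?case unfolding Cns_on_0_iff_locally_lipschitz by (intro ballI exI[of _ "1::real"] conjI) auto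
next
  case (Suc n)
  then show ?case by (intro Cns_on_Suc_I[where f' = "\<lambda>_ _. 0"]) auto
qed

lemma Cns_on_bounded_linear_compose:
  assumes "open S" "bounded_linear l" "Cns_on n 1 S f"
  shows "Cns_on n 1 S (\<lambda>x. l (f x))"
  using assms(3)
proof (induction n arbitrary: f)
  case 0
  interpret bounded_linear l by fact
  obtain B where B: "B \<ge> 0" "\<And>x. norm (l x) \<le> norm x * B" using nonneg_bounded by blast
  show ?case unfolding Cns_on_0_iff_locally_lipschitz
  proof
    fix x assume "x \<in> S"
    then obtain e C where e: "e > 0" "C \<ge> 0" "\<forall>y\<in>S \<inter> ball x e. \<forall>z\<in>S \<inter> ball x e. norm (f y - f z) \<le> C * norm (y - z)"
      using 0 unfolding Cns_on_0_iff_locally_lipschitz by blast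
    have "norm (l (f y) - l (f z)) \<le> (C * B) * norm (y - z)" if "y \<in> S \<inter> ball x e" "z \<in> S \<inter> ball x e" for y z
    proof -
      have "norm (l (f y) - l (f z)) \<le> norm (f y - f z) * B" using B(2) by (metis diff)
      also have "\<dots> \<le> (C * norm (y - z)) * B" using e(3) that B(1) by (intro mult_right_mono) auto
      finally show ?thesis by (simp add: ac_simps)
    qed
    then show "\<exists>e>0. \<exists>C\<ge>0. \<forall>y\<in>S \<inter> ball x e. \<forall>z\<in>S \<inter> ball x e. norm (l (f y) - l (f z)) \<le> C * norm (y - z)"
      using e(1,2) B(1) by (intro exI[of _ e] conjI exI[of _ "C * B"]) auto
  qed
next
  case (Suc n)
  show ?case
    by (rule Cns_on_Suc_I[OF assms(1) bounded_linear.has_derivative[OF assms(2) Cns_on_Suc_has_derivative[OF Suc.prems]]])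
      (use Suc in auto)
qed

lemma Cns_on_add:
  assumes "open S" "Cns_on n 1 S f" "Cns_on n 1 S g"
  shows "Cns_on n 1 S (\<lambda>x. f x + g x)"
  using assms(2,3)
proof (induction n arbitrary: f g)
  case 0
  show ?case unfolding Cns_on_0_iff_locally_lipschitz
  proof
    fix x assume x: "x \<in> S"
    obtain e C where e: "e > 0" "C \<ge> 0" "\<forall>y\<in>S \<inter> ball x e. \<forall>z\<in>S \<inter> ball x e. norm (f y - f z) \<le> C * norm (y - z)"
      using 0 x unfolding Cns_on_0_iff_locally_lipschitz by blast
    obtain e' C' where e': "e' > 0" "C' \<ge> 0" "\<forall>y\<in>S \<inter> ball x e'. \<forall>z\<in>S \<inter> ball x e'. norm (g y - g z) \<le> C' * norm (y - z)"
      using 0 x unfolding Cns_on_0_iff_locally_lipschitz by blast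
    have "norm (f y + g y - (f z + g z)) \<le> (C + C') * norm (y - z)"
      if "y \<in> S \<inter> ball x (min e e')" "z \<in> S \<inter> ball x (min e e')" for y z
    proof -
      have "norm (f y + g y - (f z + g z)) \<le> norm (f y - f z) + norm (g y - g z)"
        by (metis add_diff_add norm_triangle_ineq)
      also have "\<dots> \<le> C * norm (y - z) + C' * norm (y - z)"
        using e(3) e'(3) that by (intro add_mono) auto
      finally show ?thesis by (simp add: algebra_simps)
    qed
    then show "\<exists>e>0. \<exists>C\<ge>0. \<forall>y\<in>S \<inter> ball x e. \<forall>z\<in>S \<inter> ball x e. norm (f y + g y - (f z + g z)) \<le> C * norm (y - z)"
      using e e' by (intro exI[of _ "min e e'"] conjI exI[of _ "C + C'"]) auto
  qed
next
  case (Suc n)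
  show ?case
    by (rule Cns_on_Suc_I[OF assms(1) has_derivative_add[OF Cns_on_Suc_has_derivative[OF Suc.prems(1)] Cns_on_Suc_has_derivative[OF Suc.prems(2)]]])
      (use Suc in auto)
qed

lemma Cns_on_sum:
  assumes "open S" "finite I" "\<And>i. i \<in> I \<Longrightarrow> Cns_on n 1 S (f i)"
  shows "Cns_on n 1 S (\<lambda>x. \<Sum>i\<in>I. f i x)"
  using assms(2,3) by (induction I) (auto intro: Cns_on_const Cns_on_add assms(1))

lemma Cns_on_mult:
  fixes f g :: "'a::euclidean_space \<Rightarrow> real"
  assumes "open S" "Cns_on n 1 S f" "Cns_on n 1 S g"
  shows "Cns_on n 1 S (\<lambda>x. f x * g x)"
  using assms(2,3)
proof (induction n arbitrary: f g)
  case 0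
  show ?case unfolding Cns_on_0_iff_locally_lipschitz
  proof
    fix x assume x: "x \<in> S"
    obtain e C where e: "e > 0" "C \<ge> 0" "\<forall>y\<in>S \<inter> ball x e. \<forall>z\<in>S \<inter> ball x e. norm (f y - f z) \<le> C * norm (y - z)"
      using 0 x unfolding Cns_on_0_iff_locally_lipschitz by blast
    obtain e' C' where e': "e' > 0" "C' \<ge> 0" "\<forall>y\<in>S \<inter> ball x e'. \<forall>z\<in>S \<inter> ball x e'. norm (g y - g z) \<le> C' * norm (y - z)"
      using 0 x unfolding Cns_on_0_iff_locally_lipschitz by blast
    define B where "B = \<bar>f x\<bar> + C * e"
    define B' where "B' = \<bar>g x\<bar> + C' * e'"
    have B: "\<bar>f y\<bar> \<le> B" if "y \<in> S \<inter> ball x e" for y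
    proof -
      have "\<bar>f y - f x\<bar> \<le> C * norm (y - x)" using e x that by auto
      also have "\<dots> \<le> C * e" using e that by (intro mult_left_mono) (auto simp: dist_norm norm_minus_commute)
      finally show ?thesis by (simp add: B_def)
    qed
    have B': "\<bar>g y\<bar> \<le> B'" if "y \<in> S \<inter> ball x e'" for y
    proof -
      have "\<bar>g y - g x\<bar> \<le> C' * norm (y - x)" using e' x that by auto
      also have "\<dots> \<le> C' * e'" using e' that by (intro mult_left_mono) (auto simp: dist_norm norm_minus_commute)
      finally show ?thesis by (simp add: B'_def)
    qed
    have B0: "B \<ge> 0" "B' \<ge> 0" using e e' by (auto simp: B_def B'_def)
    have "norm (f y * g y - f z * g z) \<le> (B * C' + C * B') * norm (y - z)"
      if "y \<in> S \<inter> ball x (min e e')" "z \<in> S \<inter> ball x (min e e')" for y z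
    proof -
      have "f y * g y - f z * g z = f y * (g y - g z) + (f y - f z) * g z" by (simp add: algebra_simps)
      then have "norm (f y * g y - f z * g z) \<le> \<bar>f y\<bar> * \<bar>g y - g z\<bar> + \<bar>f y - f z\<bar> * \<bar>g z\<bar>"
        by (metis abs_mult norm_triangle_ineq real_norm_def)
      also have "\<dots> \<le> B * (C' * norm (y - z)) + (C * norm (y - z)) * B'"
        using e e' that B[of y] B'[of z] B0 by (intro add_mono mult_mono) auto
      finally show ?thesis by (simp add: algebra_simps)
    qed
    then show "\<exists>e>0. \<exists>C\<ge>0. \<forall>y\<in>S \<inter> ball x e. \<forall>z\<in>S \<inter> ball x e. norm (f y * g y - f z * g z) \<le> C * norm (y - z)"
      using e e' B0 by (intro exI[of _ "min e e'"] conjI exI[of _ "B * C' + C * B'"]) auto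
  qed
next
  case (Suc n)
  show ?case
  proof (rule Cns_on_Suc_I[OF assms(1) has_derivative_mult[OF Cns_on_Suc_has_derivative[OF Suc.prems(1)] Cns_on_Suc_has_derivative[OF Suc.prems(2)]]])
    fix v
    show "Cns_on n 1 S (\<lambda>x. f x * frechet_derivative g (at x) v + frechet_derivative f (at x) v * g x)"
      using Suc.prems Cns_on_pred[OF assms(1) Suc.prems(1)] Cns_on_pred[OF assms(1) Suc.prems(2)]
      by (intro Cns_on_add assms(1) Suc.IH) auto
  qed
qed

lemma Cns_on_inverse:
  fixes g :: "'a::euclidean_space \<Rightarrow> real"
  assumes "open S" "\<And>x. x \<in> S \<Longrightarrow> g x \<noteq> 0" "Cns_on n 1 S g"
  shows "Cns_on n 1 S (\<lambda>x. inverse (g x))"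
  using assms(3)
proof (induction n)
  case 0
  show ?case unfolding Cns_on_0_iff_locally_lipschitz
  proof
    fix x assume x: "x \<in> S"
    obtain e C where e: "e > 0" "C \<ge> 0" "\<forall>y\<in>S \<inter> ball x e. \<forall>z\<in>S \<inter> ball x e. norm (g y - g z) \<le> C * norm (y - z)"
      using 0 x unfolding Cns_on_0_iff_locally_lipschitz by blast
    define m where "m = \<bar>g x\<bar> / 2"
    have m: "m > 0" using assms(2) x by (simp add: m_def)
    \<comment> \<open>On this ball the Lipschitz bound moves \<open>g\<close> by at most half of
      \<open>\<bar>g x\<bar>\<close>, so \<open>\<bar>g\<bar>\<close> stays at least
      \<open>m\<close>; \<open>C + 1\<close> avoids a zero denominator.\<close>
    define d where "d = min e (m / (C + 1))"
    have d: "d > 0" using e m by (simp add: d_def)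
    have low: "m \<le> \<bar>g y\<bar>" if y: "y \<in> S \<inter> ball x d" for y
    proof -
      have "\<bar>g y - g x\<bar> \<le> C * norm (y - x)" using e(1,3) x y by (auto simp: d_def)
      also have "\<dots> \<le> (C + 1) * norm (y - x)" by (intro mult_right_mono) auto
      also have "\<dots> \<le> m" using y e(2) by (simp add: d_def dist_norm norm_minus_commute less_divide_eq mult.commute)
      finally show ?thesis unfolding m_def by linarith
    qed
    have "norm (inverse (g y) - inverse (g z)) \<le> (C / m^2) * norm (y - z)"
      if yz: "y \<in> S \<inter> ball x d" "z \<in> S \<inter> ball x d" for y z
    proof -
      have "\<bar>inverse (g y) - inverse (g z)\<bar> = \<bar>g y - g z\<bar> / (\<bar>g y\<bar> * \<bar>g z\<bar>)"
        using yz assms(2) by (simp add: inverse_diff_inverse abs_mult divide_simps abs_minus_commute)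
      also have "\<dots> \<le> (C * norm (y - z)) / (m * m)"
        using e yz low[OF yz(1)] low[OF yz(2)] m
        by (intro frac_le mult_mono mult_nonneg_nonneg mult_pos_pos) (auto simp: d_def)
      finally show ?thesis by (simp add: power2_eq_square)
    qed
    then show "\<exists>e>0. \<exists>C\<ge>0. \<forall>y\<in>S \<inter> ball x e. \<forall>z\<in>S \<inter> ball x e. norm (inverse (g y) - inverse (g z)) \<le> C * norm (y - z)"
      using d e(2) by (intro exI[of _ d] conjI exI[of _ "C / m^2"]) auto
  qed
next
  case (Suc n)
  have IH: "Cns_on n 1 S (\<lambda>x. inverse (g x))" using Suc Cns_on_pred[OF assms(1)] by blast
  show ?case
  proof (rule Cns_on_Suc_I[OF assms(1)])
    fix x assume "x \<in> S"
    then show "((\<lambda>x. inverse (g x)) has_derivative (\<lambda>v. - (inverse (g x) * frechet_derivative g (at x) v * inverse (g x)))) (at x)"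
      by (intro Deriv.has_derivative_inverse assms(2) Cns_on_Suc_has_derivative[OF Suc.prems])
  next
    fix v
    show "Cns_on n 1 S (\<lambda>x. - (inverse (g x) * frechet_derivative g (at x) v * inverse (g x)))"
      using Suc.prems IH
      by (intro Cns_on_bounded_linear_compose[where l = uminus] Cns_on_mult assms(1) bounded_linear_minus bounded_linear_ident) auto
  qed
qed

lemma Cns_on_compose:
  fixes f :: "'b::euclidean_space \<Rightarrow> real" and \<psi> :: "'a::euclidean_space \<Rightarrow> 'b"
  assumes "open S" "open T" "\<psi> ` T \<subseteq> S" "Cns_on n 1 S f" "Cns_on n 1 T \<psi>"
  shows "Cns_on n 1 T (\<lambda>x. f (\<psi> x))"
  using assms(4,5)
proof (induction n arbitrary: f)
  case 0
  show ?case unfolding Cns_on_0_iff_locally_lipschitz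
  proof
    fix x assume x: "x \<in> T"
    obtain e C where e: "e > 0" "C \<ge> 0" "\<forall>y\<in>S \<inter> ball (\<psi> x) e. \<forall>z\<in>S \<inter> ball (\<psi> x) e. norm (f y - f z) \<le> C * norm (y - z)"
      using 0 x assms(3) unfolding Cns_on_0_iff_locally_lipschitz by blast
    obtain e' C' where e': "e' > 0" "C' \<ge> 0" "\<forall>y\<in>T \<inter> ball x e'. \<forall>z\<in>T \<inter> ball x e'. norm (\<psi> y - \<psi> z) \<le> C' * norm (y - z)"
      using 0 x unfolding Cns_on_0_iff_locally_lipschitz by blast
    have "continuous_on T \<psi>" using 0 by simp
    then obtain d where d: "d > 0" "\<And>y. y \<in> T \<Longrightarrow> dist y x < d \<Longrightarrow> dist (\<psi> y) (\<psi> x) < e"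
      using e(1) x unfolding continuous_on_iff by blast
    have "norm (f (\<psi> y) - f (\<psi> z)) \<le> (C * C') * norm (y - z)"
      if yz: "y \<in> T \<inter> ball x (min d e')" "z \<in> T \<inter> ball x (min d e')" for y z
    proof -
      have "\<psi> y \<in> S \<inter> ball (\<psi> x) e" "\<psi> z \<in> S \<inter> ball (\<psi> x) e"
        using yz d(2)[of y] d(2)[of z] assms(3) by (auto simp: dist_commute)
      then have "norm (f (\<psi> y) - f (\<psi> z)) \<le> C * norm (\<psi> y - \<psi> z)" using e(3) by blast
      also have "\<dots> \<le> C * (C' * norm (y - z))" using e(2) e'(3) yz by (intro mult_left_mono) auto
      finally show ?thesis by (simp add: mult.assoc)
    qed
    then show "\<exists>e>0. \<exists>C\<ge>0. \<forall>y\<in>T \<inter> ball x e. \<forall>z\<in>T \<inter> ball x e. norm (f (\<psi> y) - f (\<psi> z)) \<le> C * norm (y - z)"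
      using e e' d(1) by (intro exI[of _ "min d e'"] conjI exI[of _ "C * C'"]) auto
  qed
next
  case (Suc n)
  \<comment> \<open>The derivative of \<open>f\<close> at \<open>\<psi> x\<close> is applied to a
    direction that varies with \<open>x\<close>, while the classes speak of fixed directions.
    Expanding in the basis leaves products of functions that belong to fixed directions, within
    reach of the induction hypothesis.\<close>
  let ?D = "\<lambda>x v. \<Sum>b\<in>Basis. (frechet_derivative \<psi> (at x) v \<bullet> b) * frechet_derivative f (at (\<psi> x)) b"
  show ?case
  proof (rule Cns_on_Suc_I[OF assms(2)])
    fix x assume x: "x \<in> T"
    then have fx: "(f has_derivative frechet_derivative f (at (\<psi> x))) (at (\<psi> x))"
      using Cns_on_Suc_has_derivative[OF Suc.prems(1)] assms(3) by blast
    interpret bounded_linear "frechet_derivative f (at (\<psi> x))"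
      using fx has_derivative_bounded_linear by blast
    have rep: "frechet_derivative f (at (\<psi> x)) w = (\<Sum>b\<in>Basis. (w \<bullet> b) * frechet_derivative f (at (\<psi> x)) b)" for w
    proof -
      have "frechet_derivative f (at (\<psi> x)) w = frechet_derivative f (at (\<psi> x)) (\<Sum>b\<in>Basis. (w \<bullet> b) *\<^sub>R b)"
        by (simp add: euclidean_representation)
      then show ?thesis by (simp add: sum scaleR)
    qed
    then have eq: "?D x = (\<lambda>v. frechet_derivative f (at (\<psi> x)) (frechet_derivative \<psi> (at x) v))"
      by (intro ext rep[symmetric])
    show "((\<lambda>x. f (\<psi> x)) has_derivative ?D x) (at x)"
      unfolding eq using has_derivative_compose[OF Cns_on_Suc_has_derivative[OF Suc.prems(2) x] fx] .
  next
    fix v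
    have "Cns_on n 1 T (\<lambda>x. frechet_derivative \<psi> (at x) v \<bullet> b)" for b
      using Suc.prems(2) by (intro Cns_on_bounded_linear_compose[where l = "\<lambda>x. x \<bullet> b"] assms(2) bounded_linear_inner_left) auto
    moreover have "Cns_on n 1 T (\<lambda>x. frechet_derivative f (at (\<psi> x)) b)" for b
      using Suc.prems(1) by (intro Suc.IH[of "\<lambda>y. frechet_derivative f (at y) b"] Cns_on_pred[OF assms(2) Suc.prems(2)]) auto
    ultimately show "Cns_on n 1 T (\<lambda>x. ?D x v)"
      by (intro Cns_on_sum assms(2) Cns_on_mult) auto
  qed
qed

text \<open>The inverse of the coordinate change \<open>x\<^sub>j := g x\<close> is as smooth as \<open>g\<close>: its derivative is a rational
  expression in the derivatives of \<open>g\<close> at the image point, so regularity bootstraps.\<close>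

lemma straighten_coordinate:
  fixes g :: "'a::euclidean_space \<Rightarrow> real"
  assumes S: "open S" and g: "Cns_on (Suc n) 1 S g" and a: "a \<in> S" and j: "j \<in> Basis"
    and nz: "frechet_derivative g (at a) j \<noteq> 0"
  obtains U V \<psi> \<kappa> where "open U" "a \<in> U" "U \<subseteq> S" "open V"
    "homeomorphism U V (\<lambda>x. x + (g x - x \<bullet> j) *\<^sub>R j) \<psi>" "Cns_on (Suc n) 1 V \<psi>"
    "\<kappa> \<ge> 0" "\<And>y v. y \<in> V \<Longrightarrow> norm (frechet_derivative \<psi> (at y) v) \<le> \<kappa> * norm v"
proof -
  let ?D = "\<lambda>x. frechet_derivative g (at x)"
  let ?\<Phi> = "\<lambda>x. x + (g x - x \<bullet> j) *\<^sub>R j"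
  let ?\<Phi>' = "\<lambda>x v. v + (?D x v - v \<bullet> j) *\<^sub>R j"
  \<comment> \<open>\<open>?\<Phi>'\<close> replaces the \<open>j\<close> coordinate of
    \<open>v\<close> by \<open>?D x v\<close>. To undo this, one adds to \<open>w\<close> the
    multiple of \<open>j\<close> for which \<open>?D x\<close> of the sum equals
    \<open>w \<bullet> j\<close>; it exists where \<open>?D x j\<close> is nonzero.\<close>
  let ?inv = "\<lambda>x w. w + ((w \<bullet> j - ?D x w) * inverse (?D x j)) *\<^sub>R j"
  have jj: "j \<bullet> j = 1" using j by simp
  have contD: "continuous_on S (\<lambda>x. ?D x v)" for v
    using g by (intro Cns_on_continuous[of n 1]) simp
  have gD: "(g has_derivative ?D x) (at x)" if "x \<in> S" for x
    using Cns_on_Suc_has_derivative[OF g that] .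
  have linD: "bounded_linear (?D x)" if "x \<in> S" for x
    using gD[OF that] has_derivative_bounded_linear by blast
  define S1 where "S1 = S \<inter> (\<lambda>x. ?D x j) -` (- {0})"
  have S1: "open S1" "a \<in> S1" "S1 \<subseteq> S"
    using continuous_open_preimage[OF contD[of j] S, of "- {0}"] a nz by (auto simp: S1_def)
  have bl: "bounded_linear (?\<Phi>' x)" if "x \<in> S1" for x
    using linD that S1(3)
    by (intro bounded_linear_add bounded_linear_ident bounded_linear_scaleR_const bounded_linear_sub
        bounded_linear_inner_left) auto
  have bli: "bounded_linear (?inv x)" if "x \<in> S1" for x
    using linD that S1(3)
    by (intro bounded_linear_add bounded_linear_ident bounded_linear_scaleR_const bounded_linear_mult_const bounded_linear_sub
        bounded_linear_inner_left) auto
  have inv1: "?inv x (?\<Phi>' x v) = v" and inv2: "?\<Phi>' x (?inv x v) = v" if "x \<in> S1" for x v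
  proof -
    interpret bounded_linear "?D x" using linD that S1(3) by blast
    have n0: "?D x j \<noteq> 0" using that by (simp add: S1_def)
    have arith: "(s - (s + r * d)) * inverse d = - r" "s + (w - s) * inverse d * d = w" if "d \<noteq> 0" for r s d w :: real
      using that by (simp_all add: field_simps)
    have "?D x (?\<Phi>' x v) = ?D x v + (?D x v - v \<bullet> j) * ?D x j" by (simp add: add scaleR)
    moreover have "?\<Phi>' x v \<bullet> j = ?D x v" by (simp add: inner_simps jj)
    ultimately have "(?\<Phi>' x v \<bullet> j - ?D x (?\<Phi>' x v)) * inverse (?D x j) = - (?D x v - v \<bullet> j)"
 
      using n0 arith[of "?D x j" "?D x v" "?D x v - v \<bullet> j"] by simp
    then show "?inv x (?\<Phi>' x v) = v" by (simp only: scaleR_minus_left add.assoc right_minus add_0_right)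
    have "?D x (?inv x v) = v \<bullet> j" using arith(2)[OF n0] by (simp add: add scaleR)
    moreover have "?inv x v \<bullet> j = v \<bullet> j + (v \<bullet> j - ?D x v) * inverse (?D x j)"
      by (simp add: inner_simps jj)
    ultimately have "?D x (?inv x v) - ?inv x v \<bullet> j = - ((v \<bullet> j - ?D x v) * inverse (?D x j))"
      by simp
    then show "?\<Phi>' x (?inv x v) = v" by (simp only: scaleR_minus_left add.assoc right_minus add_0_right)
  qed
  define B where "B x = Blinfun (?\<Phi>' x)" for x
  have B: "blinfun_apply (B x) = ?\<Phi>' x" if "x \<in> S1" for x
    unfolding B_def by (rule bounded_linear_Blinfun_apply[OF bl[OF that]])
  have der: "(?\<Phi> has_derivative blinfun_apply (B x)) (at x)" if "x \<in> S1" for x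
    unfolding B[OF that] using that S1(3) gD[of x]
    by (auto intro!: derivative_eq_intros)
  have contB: "continuous_on S1 B"
  proof (rule continuous_on_blinfun_componentwise)
    fix i :: 'a assume "i \<in> Basis"
    have "continuous_on S1 (\<lambda>x. ?\<Phi>' x i)"
      using continuous_on_subset[OF contD S1(3)] by (intro continuous_intros)
    then show "continuous_on S1 (\<lambda>x. blinfun_apply (B x) i)"
      using B by (simp cong: continuous_on_cong)
  qed
  have invB: "Blinfun (?inv a) o\<^sub>L B a = id_blinfun"
    by (rule blinfun_eqI) (simp add: bounded_linear_Blinfun_apply[OF bli[OF S1(2)]] B[OF S1(2)] inv1[OF S1(2)])
  obtain U V \<psi> \<psi>' where UV: "open U" "U \<subseteq> S1" "a \<in> U" "open V" "?\<Phi> a \<in> V" "homeomorphism U V ?\<Phi> \<psi>"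
    and \<psi>': "\<And>y. y \<in> V \<Longrightarrow> (\<psi> has_derivative (\<psi>' y)) (at y)"
    "\<And>y. y \<in> V \<Longrightarrow> \<psi>' y = inv (blinfun_apply (B (\<psi> y)))"
    by (rule inverse_function_theorem[OF S1(1) der contB S1(2) invB], assumption, rule that)
  have \<psi>V: "\<psi> y \<in> S1" if "y \<in> V" for y
    using UV(2,6) that unfolding homeomorphism_def by blast
  have psi'_eq: "\<psi>' y = ?inv (\<psi> y)" if "y \<in> V" for y
  proof -
    have "inv (?\<Phi>' (\<psi> y)) = ?inv (\<psi> y)"
      by (rule inv_equality) (use inv1[OF \<psi>V[OF that]] inv2[OF \<psi>V[OF that]] in auto)
    then show ?thesis using \<psi>'(2)[OF that] B[OF \<psi>V[OF that]] by simp
  qed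
  have der\<psi>: "(\<psi> has_derivative ?inv (\<psi> y)) (at y)" if "y \<in> V" for y
    using \<psi>'(1)[OF that] psi'_eq[OF that] by simp
  have cont\<psi>: "continuous_on V \<psi>" using UV(6) unfolding homeomorphism_def by blast
  have \<psi>im: "\<psi> ` V \<subseteq> S1" using \<psi>V by blast
  have contI: "continuous_on V (\<lambda>y. ?inv (\<psi> y) w)" for w
  proof -
    have c: "continuous_on V (\<lambda>y. ?D (\<psi> y) v)" for v
      by (rule continuous_on_compose2[OF contD cont\<psi>]) (use \<psi>im S1 in auto)
    have "?D (\<psi> y) j \<noteq> 0" if "y \<in> V" for y using \<psi>V[OF that] by (simp add: S1_def)
    then show ?thesis by (intro continuous_intros c ballI) auto
  qed
  have reg: "l \<le> Suc n \<Longrightarrow> Cns_on l 1 V \<psi>" for l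
  proof (induction l)
    case 0
    show ?case by (rule C1_locally_lipschitz[OF UV(4) der\<psi> contI])
  next
    case (Suc l)
    have IH: "Cns_on l 1 V \<psi>" using Suc by simp
    have DV: "Cns_on l 1 V (\<lambda>y. ?D (\<psi> y) v)" for v
    proof (rule Cns_on_compose[OF S1(1) UV(4) \<psi>im _ IH, of "\<lambda>x. ?D x v"])
      have "Cns_on n 1 S (\<lambda>x. ?D x v)" using g by simp
      then show "Cns_on l 1 S1 (\<lambda>x. ?D x v)"
        using Suc.prems Cns_on_1_antimono[OF S, of l n] Cns_on_subset[OF S1(3)] by auto
    qed
    show ?case
    proof (rule Cns_on_Suc_I[OF UV(4) der\<psi>])
      fix w
      have nz: "?D (\<psi> y) j \<noteq> 0" if "y \<in> V" for y using \<psi>V[OF that] by (simp add: S1_def)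
      have "Cns_on l 1 V (\<lambda>y. (w \<bullet> j + - ?D (\<psi> y) w) * inverse (?D (\<psi> y) j))"
        by (intro Cns_on_mult Cns_on_add Cns_on_const UV(4) Cns_on_bounded_linear_compose[where l = uminus]
            bounded_linear_minus bounded_linear_ident DV Cns_on_inverse nz)
      then have "Cns_on l 1 V (\<lambda>y. w + ((w \<bullet> j + - ?D (\<psi> y) w) * inverse (?D (\<psi> y) j)) *\<^sub>R j)"
        by (intro Cns_on_add UV(4) Cns_on_const Cns_on_bounded_linear_compose[where l = "\<lambda>r. r *\<^sub>R j"]
            bounded_linear_scaleR_left)
      then show "Cns_on l 1 V (\<lambda>y. ?inv (\<psi> y) w)" by simp
    qed
  qed
  \<comment> \<open>The target is shrunk to a ball on which the derivative of \<open>\<psi>\<close>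
    is bounded, so that \<open>\<psi>\<close> multiplies the speed of a curve by at most
    \<open>\<kappa>\<close>.\<close>
  obtain e \<kappa> where e: "e > 0" "ball (?\<Phi> a) e \<subseteq> V" "\<kappa> \<ge> 0"
    "\<And>y v. y \<in> ball (?\<Phi> a) e \<Longrightarrow> norm (?inv (\<psi> y) v) \<le> \<kappa> * norm v"
    by (rule locally_bounded_derivative[OF UV(4) der\<psi> contI UV(5)], assumption, rule that)
  define W where "W = ball (?\<Phi> a) e"
  define U' where "U' = U \<inter> ?\<Phi> -` W"
  have cont\<Phi>: "continuous_on U ?\<Phi>" using UV(6) unfolding homeomorphism_def by blast
  have WV: "W \<subseteq> V" using e by (simp add: W_def)
  have hom: "homeomorphism U' W ?\<Phi> \<psi>"
  proof (rule homeomorphism_of_subsets[OF UV(6)])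
    show "?\<Phi> ` U' = W"
    proof
      show "W \<subseteq> ?\<Phi> ` U'"
      proof
        fix y assume y: "y \<in> W"
        then have yV: "y \<in> V" using WV by blast
        have eq: "?\<Phi> (\<psi> y) = y" by (rule homeomorphism_apply2[OF UV(6) yV])
        have "\<psi> y \<in> U" using homeomorphism_image2[OF UV(6)] yV by blast
        then have "\<psi> y \<in> U'" using y unfolding U'_def by (simp add: eq)
        then show "y \<in> ?\<Phi> ` U'" by (rule rev_image_eqI) (rule eq[symmetric])
      qed
    qed (auto simp: U'_def)
  qed (use WV in \<open>auto simp: U'_def\<close>)
  show ?thesis
  proof (rule that[OF _ _ _ _ hom])
    show "open U'" unfolding U'_def by (rule continuous_open_preimage[OF cont\<Phi> UV(1)]) (simp add: W_def)
    show "a \<in> U'" using UV(3) e(1) by (simp add: U'_def W_def)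
    show "U' \<subseteq> S" using UV(2) S1(3) by (auto simp: U'_def)
    show "open W" by (simp add: W_def)
    show "Cns_on (Suc n) 1 W \<psi>" using reg[of "Suc n"] Cns_on_subset[OF WV] by blast
    show "\<kappa> \<ge> 0" by fact
    fix y v assume y: "y \<in> W"
    then have "frechet_derivative \<psi> (at y) = ?inv (\<psi> y)"
      using der\<psi>[of y] WV frechet_derivative_at[symmetric] by blast
    then show "norm (frechet_derivative \<psi> (at y) v) \<le> \<kappa> * norm v"
      using e(4)[of y v] y by (simp add: W_def)
  qed
qed

section \<open>The Morse-Sard theorem for real functions\<close>

lemma negligible_image_locally:
  fixes A :: "'a::euclidean_space set" and u :: "'a \<Rightarrow> 'b::euclidean_space"
  assumes "\<And>a. a \<in> A \<Longrightarrow> \<exists>U. open U \<and> a \<in> U \<and> negligible (u ` (A \<inter> U))"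
  shows "negligible (u ` A)"
proof -
  define \<F> where "\<F> = {U. open U \<and> negligible (u ` (A \<inter> U))}"
  obtain \<F>' where F: "\<F>' \<subseteq> \<F>" "countable \<F>'" "\<Union>\<F>' = \<Union>\<F>"
    using Lindelof[of \<F>] by (auto simp: \<F>_def)
  have "A \<subseteq> \<Union>\<F>" using assms by (auto simp: \<F>_def)
  then have "u ` A = u ` (A \<inter> \<Union>\<F>')" using F(3) by (simp add: Int_absorb2)
  also have "\<dots> = \<Union>((\<lambda>U. u ` (A \<inter> U)) ` \<F>')" by blast
  finally have "u ` A = \<Union>((\<lambda>U. u ` (A \<inter> U)) ` \<F>')" .
  moreover have "negligible (\<Union>((\<lambda>U. u ` (A \<inter> U)) ` \<F>'))"
    using F(1,2) by (intro negligible_countable_Union) (auto simp: \<F>_def)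
  ultimately show ?thesis by simp
qed

text \<open>The points where some function of \<open>F\<close> is nonzero form an open set, so the
  common zeros are \<open>A\<close> minus an open set. Measurability has to survive the splitting of
  \<open>A\<close>, since the Hoelder criterion encloses its set in an open set of small
  excess.\<close>

lemma sets_lebesgue_Int_zeros:
  fixes A :: "'a::euclidean_space set" and F :: "('a \<Rightarrow> real) set"
  assumes "A \<in> sets lebesgue" "open S" "A \<subseteq> S" "\<And>f. f \<in> F \<Longrightarrow> continuous_on S f"
  shows "{a\<in>A. \<forall>f\<in>F. f a = 0} \<in> sets lebesgue"
proof -
  have "open (S \<inter> f -` (- {0}))" if "f \<in> F" for f
    by (rule continuous_open_preimage[OF assms(4)[OF that] assms(2)]) auto
  then have "open (\<Union>f\<in>F. S \<inter> f -` (- {0}))" by blast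
  then have "A - (\<Union>f\<in>F. S \<inter> f -` (- {0})) \<in> sets lebesgue"
    using assms(1) by (intro sets.Diff) auto
  also have "A - (\<Union>f\<in>F. S \<inter> f -` (- {0})) = {a\<in>A. \<forall>f\<in>F. f a = 0}"
    using assms(3) by auto
  finally show ?thesis .
qed

section \<open>Vanishing along curves in coordinate subspaces\<close>

text \<open>\<open>J\<close> collects the coordinates already straightened. The ambient type stays
  fixed during the induction, so a drop of the dimension is recorded as a growth of
  \<open>J\<close>.\<close>

definition coordinate_subspace :: "'a::euclidean_space set \<Rightarrow> 'a set" where
  "coordinate_subspace J = {x. \<forall>b\<in>J. x \<bullet> b = 0}"

text \<open>Curves replace segments because straightening bends segments, whereas a bound on the
  speed survives up to a constant factor. The parameter interval has length 1, so \<open>l\<close>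
  also bounds the length of the curve.\<close>

definition curve_in :: "'a::euclidean_space set \<Rightarrow> real \<Rightarrow> (real \<Rightarrow> 'a) \<Rightarrow> bool" where
  "curve_in X l \<sigma> \<longleftrightarrow> (\<exists>\<sigma>'. \<forall>t\<in>{0..1}. \<sigma> t \<in> X \<and> (\<sigma> has_vector_derivative \<sigma>' t) (at t within {0..1}) \<and> norm (\<sigma>' t) \<le> l)"

text \<open>If all functions of \<open>F\<close> are of order \<open>l^(n+1)\<close> along a curve of speed \<open>l\<close> that starts in \<open>A\<close>, then
  the increment of \<open>u\<close> is of order \<open>l^m\<close>. Unlike the smoothness of \<open>u\<close>, this passes through
  straightenings of class \<open>C\<^bsup>n,1\<^esup>\<close> without loss.\<close>

definition vanishing_control ::
  "('a::euclidean_space \<Rightarrow> real) \<Rightarrow> ('a \<Rightarrow> real) set \<Rightarrow> nat \<Rightarrow> nat \<Rightarrow> 'a set \<Rightarrow> 'a set \<Rightarrow> bool" where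
  "vanishing_control u F n m A X \<longleftrightarrow> (\<forall>C\<ge>0. \<exists>C'. \<forall>\<sigma> l. 0 \<le> l \<longrightarrow> curve_in X l \<sigma> \<longrightarrow> \<sigma> 0 \<in> A \<longrightarrow>
     (\<forall>t\<in>{0..1}. \<forall>f\<in>F. \<bar>f (\<sigma> t)\<bar> \<le> C * l ^ Suc n) \<longrightarrow> \<bar>u (\<sigma> 1) - u (\<sigma> 0)\<bar> \<le> C' * l ^ m)"

text \<open>A curve inside the coordinate subspace has no velocity in the directions of
  \<open>J\<close>, so the partial derivatives in the other directions alone control the increment.
  This is why the families of derivatives in the induction can omit the directions of
  \<open>J\<close>.\<close>

lemma curve_increment:
  fixes g :: "'a::euclidean_space \<Rightarrow> real" and K l :: real
  assumes \<sigma>: "curve_in (S \<inter> coordinate_subspace J) l \<sigma>" and J: "J \<subseteq> Basis"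
    and g: "\<And>x. x \<in> S \<Longrightarrow> (g has_derivative frechet_derivative g (at x)) (at x)"
    and l: "l \<ge> 0" and K: "K \<ge> 0"
    and bd: "\<And>t b. t \<in> {0..1} \<Longrightarrow> b \<in> Basis - J \<Longrightarrow> \<bar>frechet_derivative g (at (\<sigma> t)) b\<bar> \<le> K"
    and t: "t \<in> {0..1}"
  shows "\<bar>g (\<sigma> t) - g (\<sigma> 0)\<bar> \<le> real DIM('a) * K * l"
proof -
  obtain \<sigma>' where s: "\<And>t. t \<in> {0..1} \<Longrightarrow> \<sigma> t \<in> S" "\<And>t b. t \<in> {0..1} \<Longrightarrow> b \<in> J \<Longrightarrow> \<sigma> t \<bullet> b = 0"
    and s': "\<And>t. t \<in> {0..1} \<Longrightarrow> (\<sigma> has_vector_derivative \<sigma>' t) (at t within {0..1})"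
      "\<And>t. t \<in> {0..1} \<Longrightarrow> norm (\<sigma>' t) \<le> l"
    using \<sigma> unfolding curve_in_def coordinate_subspace_def by blast
  let ?D = "\<lambda>t. frechet_derivative g (at (\<sigma> t))"
  have tangent: "\<sigma>' t \<bullet> b = 0" if t: "t \<in> {0..1}" and b: "b \<in> J" for t b
  proof -
    have "((\<lambda>t. \<sigma> t \<bullet> b) has_vector_derivative \<sigma>' t \<bullet> b) (at t within {0..1})"
      using bounded_linear.has_vector_derivative[OF bounded_linear_inner_left s'(1)[OF t]] .
    moreover have "((\<lambda>t. \<sigma> t \<bullet> b) has_vector_derivative 0) (at t within {0..1})"
      by (rule has_vector_derivative_transform[OF t _ has_vector_derivative_const[of 0]]) (use s(2) b in auto)
    ultimately show ?thesis
      using vector_derivative_unique_within_closed_interval[of 0 1 t] t by force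
  qed
  have d: "((\<lambda>t. g (\<sigma> t)) has_field_derivative ?D t (\<sigma>' t)) (at t within {0..1})" if t: "t \<in> {0..1}" for t
  proof -
    have "((g \<circ> \<sigma>) has_vector_derivative ?D t (\<sigma>' t)) (at t within {0..1})"
      by (rule vector_derivative_diff_chain_within[OF s'(1)[OF t] has_derivative_at_withinI[OF g[OF s(1)[OF t]]]])
    then show ?thesis by (simp add: o_def has_real_derivative_iff_has_vector_derivative)
  qed
  have D: "norm (?D t (\<sigma>' t)) \<le> real DIM('a) * K * l" if t: "t \<in> {0..1}" for t
  proof -
    interpret bounded_linear "?D t" using g[OF s(1)[OF t]] has_derivative_bounded_linear by blast
    have "?D t (\<sigma>' t) = ?D t (\<Sum>b\<in>Basis. (\<sigma>' t \<bullet> b) *\<^sub>R b)" by (simp add: euclidean_representation)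
    also have "\<dots> = (\<Sum>b\<in>Basis. (\<sigma>' t \<bullet> b) * ?D t b)" by (simp add: sum scaleR)
    finally have "norm (?D t (\<sigma>' t)) \<le> (\<Sum>b\<in>Basis. \<bar>(\<sigma>' t \<bullet> b) * ?D t b\<bar>)"
      by (simp add: sum_abs)
    also have "\<dots> \<le> (\<Sum>b::'a\<in>Basis. l * K :: real)"
    proof (rule sum_mono)
      fix b :: 'a assume b: "b \<in> Basis"
      show "\<bar>(\<sigma>' t \<bullet> b) * ?D t b\<bar> \<le> l * K"
      proof (cases "b \<in> J")
        case True
        then show ?thesis using tangent[OF t] l K by simp
      next
        case False
        have "\<bar>\<sigma>' t \<bullet> b\<bar> \<le> l" using Basis_le_norm[OF b, of "\<sigma>' t"] s'(2)[OF t] by linarith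
        then show ?thesis unfolding abs_mult using bd[OF t, of b] b False l by (intro mult_mono) auto
      qed
    qed
    finally show ?thesis by (simp add: ac_simps)
  qed
  have "norm (g (\<sigma> t) - g (\<sigma> 0)) \<le> (real DIM('a) * K * l) * norm (t - 0)"
    by (rule field_differentiable_bound[OF _ d D]) (use t in auto)
  also have "\<dots> \<le> (real DIM('a) * K * l) * 1" using t l K by (intro mult_left_mono) auto
  finally show ?thesis by simp
qed

lemma curve_in_segment:
  assumes "x \<in> X" "y \<in> X" "convex X"
  shows "curve_in X (norm (x - y)) (\<lambda>t. y + t *\<^sub>R (x - y))"
  unfolding curve_in_def
proof (intro exI[of _ "\<lambda>_. x - y"] ballI conjI)
  fix t :: real assume t: "t \<in> {0..1}"
  have "y + t *\<^sub>R (x - y) = (1 - t) *\<^sub>R y + t *\<^sub>R x" by (simp add: algebra_simps)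
  also have "\<dots> \<in> X" using assms t by (intro convexD) auto
  finally show "y + t *\<^sub>R (x - y) \<in> X" .
  show "((\<lambda>t. y + t *\<^sub>R (x - y)) has_vector_derivative (x - y)) (at t within {0..1})"
    by (auto intro!: derivative_eq_intros)
qed simp

lemma curve_in_mono: "curve_in X l \<sigma> \<Longrightarrow> X \<subseteq> Y \<Longrightarrow> curve_in Y l \<sigma>"
  unfolding curve_in_def by blast

lemma curve_in_image:
  assumes \<sigma>: "curve_in X l \<sigma>" and l: "l \<ge> 0" and \<psi>: "\<psi> ` X \<subseteq> Y"
    "\<And>x. x \<in> X \<Longrightarrow> (\<psi> has_derivative \<psi>' x) (at x)" "\<And>x v. x \<in> X \<Longrightarrow> norm (\<psi>' x v) \<le> \<kappa> * norm v" and "\<kappa> \<ge> 0"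
  shows "curve_in Y (\<kappa> * l) (\<psi> \<circ> \<sigma>)"
proof -
  obtain \<sigma>' where s: "\<And>t. t \<in> {0..1} \<Longrightarrow> \<sigma> t \<in> X"
      "\<And>t. t \<in> {0..1} \<Longrightarrow> (\<sigma> has_vector_derivative \<sigma>' t) (at t within {0..1})"
      "\<And>t. t \<in> {0..1} \<Longrightarrow> norm (\<sigma>' t) \<le> l"
    using \<sigma> unfolding curve_in_def by blast
  show ?thesis unfolding curve_in_def
  proof (intro exI[of _ "\<lambda>t. \<psi>' (\<sigma> t) (\<sigma>' t)"] ballI conjI)
    fix t :: real assume t: "t \<in> {0..1}"
    show "(\<psi> \<circ> \<sigma>) t \<in> Y" using \<psi>(1) s(1)[OF t] by auto
    show "(\<psi> \<circ> \<sigma> has_vector_derivative \<psi>' (\<sigma> t) (\<sigma>' t)) (at t within {0..1})"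
      by (rule vector_derivative_diff_chain_within[OF s(2)[OF t] has_derivative_at_withinI[OF \<psi>(2)[OF s(1)[OF t]]]])
    have "norm (\<psi>' (\<sigma> t) (\<sigma>' t)) \<le> \<kappa> * norm (\<sigma>' t)" using \<psi>(3) s(1)[OF t] by blast
    also have "\<dots> \<le> \<kappa> * l" using s(3)[OF t] \<open>\<kappa> \<ge> 0\<close> by (intro mult_left_mono)
    finally show "norm (\<psi>' (\<sigma> t) (\<sigma>' t)) \<le> \<kappa> * l" .
  qed
qed

lemma finite_common_lipschitz:
  fixes F :: "('a::euclidean_space \<Rightarrow> real) set"
  assumes "finite F" "open S" "\<And>f. f \<in> F \<Longrightarrow> Cns_on 0 1 S f" "a \<in> S"
  obtains e L where "e > 0" "L \<ge> 0" "ball a e \<subseteq> S"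
    "\<And>f y z. f \<in> F \<Longrightarrow> y \<in> ball a e \<Longrightarrow> z \<in> ball a e \<Longrightarrow> \<bar>f y - f z\<bar> \<le> L * norm (y - z)"
proof -
  have "\<exists>e>0. \<exists>L\<ge>0. ball a e \<subseteq> S \<and> (\<forall>f\<in>F. \<forall>y\<in>ball a e. \<forall>z\<in>ball a e. \<bar>f y - f z\<bar> \<le> L * norm (y - z))"
    using assms(1,3)
  proof (induction F)
    case empty
    obtain e where "e > 0" "ball a e \<subseteq> S" using assms(2,4) openE by blast
    then show ?case by (intro exI[of _ e] conjI exI[of _ 0]) auto
  next
    case (insert f F)
    then obtain e L where e: "e > 0" "L \<ge> 0" "ball a e \<subseteq> S"
      "\<And>f y z. f \<in> F \<Longrightarrow> y \<in> ball a e \<Longrightarrow> z \<in> ball a e \<Longrightarrow> \<bar>f y - f z\<bar> \<le> L * norm (y - z)" by blast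
    have "Cns_on 0 1 S f" using insert by blast
    then obtain e' L' where e': "e' > 0" "L' \<ge> 0"
      "\<forall>y\<in>S \<inter> ball a e'. \<forall>z\<in>S \<inter> ball a e'. norm (f y - f z) \<le> L' * norm (y - z)"
      using assms(4) unfolding Cns_on_0_iff_locally_lipschitz by blast
    have "\<bar>k y - k z\<bar> \<le> (L + L') * norm (y - z)"
      if k: "k \<in> insert f F" and yz: "y \<in> ball a (min e e')" "z \<in> ball a (min e e')" for k y z
    proof (cases "k = f")
      case True
      have "\<bar>f y - f z\<bar> \<le> L' * norm (y - z)" using e'(3)[rule_format, of y z] e(3) yz by (simp add: subset_eq)
      also have "\<dots> \<le> (L + L') * norm (y - z)" using e by (intro mult_right_mono) auto
      finally show ?thesis using True by simp
    next
      case False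
      then have "\<bar>k y - k z\<bar> \<le> L * norm (y - z)" using e(4) k yz by auto
      also have "\<dots> \<le> (L + L') * norm (y - z)" using e' by (intro mult_right_mono) auto
      finally show ?thesis .
    qed
    then show ?case using e e'
      by (intro exI[of _ "min e e'"] conjI exI[of _ "L + L'"]) auto
  qed
  then show ?thesis using that by blast
qed

lemma convex_coordinate_subspace: "convex (coordinate_subspace J)"
  unfolding coordinate_subspace_def by (auto simp: convex_def inner_simps)

text \<open>Induction on \<open>n\<close> plus the number of free coordinates. Nothing is asked of
  \<open>u\<close> beyond the control, so that \<open>u\<close> may be replaced by
  \<open>u \<circ> \<psi>\<close>. In the base case \<open>n = 0\<close> the family \<open>F\<close>
  is locally Lipschitz and zero on \<open>A\<close>, hence of order \<open>l\<close> along a segment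
  of length \<open>l\<close> that starts in \<open>A\<close>; the control then turns into the
  Hoelder estimate of order \<open>DIM('a)\<close>.\<close>

lemma negligible_image_vanishing:
  fixes u :: "'a::euclidean_space \<Rightarrow> real"
  assumes dim: "DIM('a) \<ge> 2"
  shows "\<lbrakk>open S; J \<subseteq> Basis; A \<in> sets lebesgue; A \<subseteq> S \<inter> coordinate_subspace J; finite F;
    \<And>f. f \<in> F \<Longrightarrow> Cns_on n 1 S f; \<And>f a. f \<in> F \<Longrightarrow> a \<in> A \<Longrightarrow> f a = 0;
    vanishing_control u F n DIM('a) A (S \<inter> coordinate_subspace J)\<rbrakk> \<Longrightarrow> negligible (u ` A)"
proof (induction "n + card (Basis - J)" arbitrary: n J A F S u rule: less_induct)
  case less
  note S = less.prems(1) and J = less.prems(2) and A = less.prems(3,4) and F = less.prems(5-7)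
  let ?V = "coordinate_subspace J"
  note ctrl = less.prems(8)[unfolded vanishing_control_def, rule_format]
  show ?case
  proof (cases n)
    case 0
    show ?thesis
    proof (rule negligible_image_locally)
      fix a assume "a \<in> A"
      then have "a \<in> S" using A by blast
      then obtain e L where e: "e > 0" "L \<ge> 0" "ball a e \<subseteq> S"
        "\<And>f y z. f \<in> F \<Longrightarrow> y \<in> ball a e \<Longrightarrow> z \<in> ball a e \<Longrightarrow> \<bar>f y - f z\<bar> \<le> L * norm (y - z)"
        using finite_common_lipschitz[of F S a] F S 0 by metis
      obtain C' where C': "\<And>\<sigma> l. 0 \<le> l \<Longrightarrow> curve_in (S \<inter> ?V) l \<sigma> \<Longrightarrow> \<sigma> 0 \<in> A \<Longrightarrow>
          (\<forall>t\<in>{0..1}. \<forall>f\<in>F. \<bar>f (\<sigma> t)\<bar> \<le> L * l ^ Suc n) \<Longrightarrow> \<bar>u (\<sigma> 1) - u (\<sigma> 0)\<bar> \<le> C' * l ^ DIM('a)"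
        using ctrl[OF e(2)] by blast
      have "\<bar>u x - u y\<bar> \<le> C' * norm (x - y) ^ DIM('a)" if xy: "x \<in> A \<inter> ball a e" "y \<in> A \<inter> ball a e" for x y
      proof -
        let ?\<sigma> = "\<lambda>t. y + t *\<^sub>R (x - y)"
        have cv: "curve_in (ball a e \<inter> ?V) (norm (x - y)) ?\<sigma>"
          using xy A by (intro curve_in_segment convex_Int convex_coordinate_subspace) auto
        have "\<bar>f (?\<sigma> t)\<bar> \<le> L * norm (x - y) ^ Suc n" if t: "t \<in> {0..1}" and f: "f \<in> F" for t f
        proof -
          have "?\<sigma> t \<in> ball a e" using cv t unfolding curve_in_def by blast
          then have "\<bar>f (?\<sigma> t) - f y\<bar> \<le> L * norm (?\<sigma> t - y)" using e(4)[OF f] xy by blast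
          also have "\<dots> = L * (t * norm (x - y))" using t by simp
          also have "\<dots> \<le> L * (1 * norm (x - y))" using t e(2) by (intro mult_left_mono mult_right_mono) auto
          finally show ?thesis using F(3)[OF f, of y] xy 0 by simp
        qed
        moreover have "curve_in (S \<inter> ?V) (norm (x - y)) ?\<sigma>" using curve_in_mono[OF cv] e(3) by blast
        ultimately have "\<bar>u (?\<sigma> 1) - u (?\<sigma> 0)\<bar> \<le> C' * norm (x - y) ^ DIM('a)"
          using xy by (intro C') auto
        then show ?thesis by simp
      qed
      then have "negligible (u ` (A \<inter> ball a e))"
        using A(1) by (intro negligible_image_Holder_DIM[OF dim]) (auto intro: bounded_subset[OF bounded_ball])
      then show "\<exists>U. open U \<and> a \<in> U \<and> negligible (u ` (A \<inter> U))"
        using e(1) by (intro exI[of _ "ball a e"]) auto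
    qed
  next
    case (Suc k)
    have fD: "(f has_derivative frechet_derivative f (at x)) (at x)" if "f \<in> F" "x \<in> S" for f x
      using Cns_on_Suc_has_derivative[of k 1 S f x] F(2)[OF that(1)] that(2) Suc by simp
    define F' where "F' = (\<lambda>(f, j) x. frechet_derivative f (at x) j) ` (F \<times> (Basis - J))"
    have F'k: "Cns_on k 1 S g" if "g \<in> F'" for g
      using that F(2) Suc by (auto simp: F'_def)
    define A0 where "A0 = {a\<in>A. \<forall>g\<in>F'. g a = 0}"
    \<comment> \<open>If the free derivatives of \<open>F\<close> have order l^(k+1) along a curve,
      integration from the zero at its start gives \<open>F\<close> the order l^(k+2) = l^(n+1).
      Hence control by \<open>F\<close> at level \<open>n\<close> implies control by
      \<open>F'\<close> at level \<open>k\<close>.\<close>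
    have neg0: "negligible (u ` A0)"
    proof (rule less.hyps[of k J S A0 F' u])
      show "k + card (Basis - J) < n + card (Basis - J)" using Suc by simp
      show "A0 \<in> sets lebesgue"
        unfolding A0_def using A F'k Cns_on_continuous by (intro sets_lebesgue_Int_zeros[OF A(1) S]) blast+
      show "finite F'" using F(1) by (simp add: F'_def)
      show "vanishing_control u F' k DIM('a) A0 (S \<inter> ?V)"
        unfolding vanishing_control_def
      proof (intro allI impI)
        fix C :: real assume C: "C \<ge> 0"
        then have "real DIM('a) * C \<ge> 0" by simp
        then obtain C' where C': "\<And>\<sigma> l. 0 \<le> l \<Longrightarrow> curve_in (S \<inter> ?V) l \<sigma> \<Longrightarrow> \<sigma> 0 \<in> A \<Longrightarrow>
          (\<forall>t\<in>{0..1}. \<forall>f\<in>F. \<bar>f (\<sigma> t)\<bar> \<le> (real DIM('a) * C) * l ^ Suc n) \<Longrightarrow> \<bar>u (\<sigma> 1) - u (\<sigma> 0)\<bar> \<le> C' * l ^ DIM('a)"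
          using ctrl by blast
        have "\<bar>u (\<sigma> 1) - u (\<sigma> 0)\<bar> \<le> C' * l ^ DIM('a)"
          if l: "0 \<le> l" and cv: "curve_in (S \<inter> ?V) l \<sigma>" and s0: "\<sigma> 0 \<in> A0"
            and bd: "\<forall>t\<in>{0..1}. \<forall>f\<in>F'. \<bar>f (\<sigma> t)\<bar> \<le> C * l ^ Suc k" for \<sigma> l
        proof (rule C'[OF l cv])
          show s0A: "\<sigma> 0 \<in> A" using s0 by (simp add: A0_def)
          show "\<forall>t\<in>{0..1}. \<forall>f\<in>F. \<bar>f (\<sigma> t)\<bar> \<le> (real DIM('a) * C) * l ^ Suc n"
          proof (intro ballI)
            fix t :: real and f assume t: "t \<in> {0..1}" and f: "f \<in> F"
            have "\<bar>f (\<sigma> t) - f (\<sigma> 0)\<bar> \<le> real DIM('a) * (C * l ^ Suc k) * l"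
            proof (rule curve_increment[OF cv J fD[OF f] l _ _ t])
              fix t b assume "t \<in> {0..1::real}" "b \<in> Basis - J"
              moreover have "(\<lambda>x. frechet_derivative f (at x) b) \<in> F'"
                using f \<open>b \<in> Basis - J\<close> unfolding F'_def by (intro image_eqI[of _ _ "(f, b)"]) auto
              ultimately show "\<bar>frechet_derivative f (at (\<sigma> t)) b\<bar> \<le> C * l ^ Suc k"
                using bd[rule_format, of t "\<lambda>x. frechet_derivative f (at x) b"] by simp
            qed (use C l in auto)
            then show "\<bar>f (\<sigma> t)\<bar> \<le> (real DIM('a) * C) * l ^ Suc n"
              using F(3)[OF f s0A] by (simp add: Suc ac_simps)
          qed
        qed
        then show "\<exists>C'. \<forall>\<sigma> l. 0 \<le> l \<longrightarrow> curve_in (S \<inter> ?V) l \<sigma> \<longrightarrow> \<sigma> 0 \<in> A0 \<longrightarrow>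
          (\<forall>t\<in>{0..1}. \<forall>f\<in>F'. \<bar>f (\<sigma> t)\<bar> \<le> C * l ^ Suc k) \<longrightarrow> \<bar>u (\<sigma> 1) - u (\<sigma> 0)\<bar> \<le> C' * l ^ DIM('a)"
          by blast
      qed
    qed (use S J A F'k in \<open>auto simp: A0_def\<close>)
    have neg1: "negligible (u ` (A - A0))"
    proof (rule negligible_image_locally)
      fix a assume a: "a \<in> A - A0"
      then obtain f0 j where f0: "f0 \<in> F" and j: "j \<in> Basis" "j \<notin> J" and nz: "frechet_derivative f0 (at a) j \<noteq> 0"
        by (auto simp: A0_def F'_def)
      have f0n: "Cns_on (Suc k) 1 S f0" using F(2)[OF f0] Suc by simp
      have aS: "a \<in> S" using a A by blast
      \<comment> \<open>\<open>\<Phi>\<close> makes \<open>f0\<close> the coordinate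
        \<open>j\<close> and leaves the coordinates in \<open>J\<close> untouched. Since
        \<open>f0\<close> vanishes on \<open>A\<close>, the image of \<open>A \<inter> U\<close>
        lies in one more coordinate hyperplane.\<close>
      define \<Phi> where "\<Phi> = (\<lambda>x. x + (f0 x - x \<bullet> j) *\<^sub>R j)"
      obtain U V \<psi> \<kappa> where UV: "open U" "a \<in> U" "U \<subseteq> S" "open V" "homeomorphism U V \<Phi> \<psi>"
        and \<psi>: "Cns_on (Suc k) 1 V \<psi>" and \<kappa>: "\<kappa> \<ge> 0"
          "\<And>y v. y \<in> V \<Longrightarrow> norm (frechet_derivative \<psi> (at y) v) \<le> \<kappa> * norm v"
        by (rule straighten_coordinate[OF S f0n aS j(1) nz, folded \<Phi>_def], rule that)
      let ?J = "insert j J" and ?F = "(\<lambda>f. f \<circ> \<psi>) ` F"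
      define A' where "A' = \<Phi> ` (A \<inter> U)"
      have \<psi>\<Phi>: "\<psi> (\<Phi> x) = x" if "x \<in> U" for x using UV(5) that by (rule homeomorphism_apply1)
      have \<Phi>\<psi>: "\<Phi> (\<psi> y) = y" if "y \<in> V" for y using UV(5) that by (rule homeomorphism_apply2)
      have \<psi>V: "\<psi> ` V = U" using UV(5) by (rule homeomorphism_image2)
      have \<Phi>b: "\<Phi> x \<bullet> b = x \<bullet> b" if "b \<in> J" for x b
      proof -
        have "j \<bullet> b = 0" using that j J by (intro inner_not_same_Basis) auto
        then show ?thesis by (simp add: \<Phi>_def inner_simps)
      qed
      have \<Phi>j: "\<Phi> x \<bullet> j = f0 x" for x using j by (simp add: \<Phi>_def inner_simps)
      have A'sub: "A' \<subseteq> V \<inter> coordinate_subspace ?J"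
      proof
        fix y assume "y \<in> A'"
        then obtain x where x: "x \<in> A" "x \<in> U" "y = \<Phi> x" by (auto simp: A'_def)
        have "y \<in> V" using homeomorphism_image1[OF UV(5)] x by blast
        moreover have "\<Phi> x \<bullet> j = 0" using F(3)[OF f0 x(1)] \<Phi>j by simp
        moreover have "\<forall>b\<in>J. \<Phi> x \<bullet> b = 0" using x(1) A \<Phi>b by (auto simp: coordinate_subspace_def)
        ultimately show "y \<in> V \<inter> coordinate_subspace ?J" using x(3) by (simp add: coordinate_subspace_def)
      qed
      have \<psi>sub: "\<psi> ` (V \<inter> coordinate_subspace ?J) \<subseteq> S \<inter> ?V"
      proof (clarify, rule IntI)
        fix y assume y: "y \<in> V" "y \<in> coordinate_subspace ?J"
        show "\<psi> y \<in> S" using \<psi>V y UV(3) by blast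
        show "\<psi> y \<in> ?V"
          using y \<Phi>b[of _ "\<psi> y"] \<Phi>\<psi>[OF y(1)] by (auto simp: coordinate_subspace_def)
      qed
      \<comment> \<open>The level \<open>n\<close> is kept: \<open>\<psi>\<close> has the class
        C^{n,1} of the functions in \<open>F\<close>, and so do their composites with it. The
        progress is the new frozen coordinate \<open>j\<close>.\<close>
      have "negligible ((u \<circ> \<psi>) ` A')"
      proof (rule less.hyps[of n ?J V A' ?F "u \<circ> \<psi>"])
        have "Basis - insert j J \<subset> Basis - J" using j by auto
        then show "n + card (Basis - insert j J) < n + card (Basis - J)"
          by (simp add: psubset_card_mono)
        \<comment> \<open>Being contained in a hyperplane, \<open>A'\<close> is a null set and
          thereby measurable.\<close>
        show "A' \<in> sets lebesgue"
        proof -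
          have "negligible {x::'a. x \<bullet> j = 0}" using negligible_standard_hyperplane[OF j(1)] by simp
          then have "negligible A'"
            by (rule negligible_subset) (use A'sub in \<open>auto simp: coordinate_subspace_def\<close>)
          then show ?thesis by (rule negligible_imp_sets)
        qed
        show "Cns_on n 1 V f" if fF: "f \<in> ?F" for f
        proof -
          obtain g where g: "g \<in> F" "f = g \<circ> \<psi>" using fF by blast
          have "Cns_on n 1 V (\<lambda>x. g (\<psi> x))"
            using Cns_on_compose[OF S UV(4) _ F(2)[OF g(1)]] \<psi> \<psi>V UV(3) Suc by auto
          then show ?thesis by (simp add: g(2) o_def)
        qed
        show "f y = 0" if "f \<in> ?F" "y \<in> A'" for f y
          using that F(3) \<psi>\<Phi> by (auto simp: A'_def)
        show "vanishing_control (u \<circ> \<psi>) ?F n DIM('a) A' (V \<inter> coordinate_subspace ?J)"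
          unfolding vanishing_control_def
        proof (intro allI impI)
          fix C :: real assume C: "C \<ge> 0"
          then obtain C' where C': "\<And>\<sigma> l. 0 \<le> l \<Longrightarrow> curve_in (S \<inter> ?V) l \<sigma> \<Longrightarrow> \<sigma> 0 \<in> A \<Longrightarrow>
            (\<forall>t\<in>{0..1}. \<forall>f\<in>F. \<bar>f (\<sigma> t)\<bar> \<le> C * l ^ Suc n) \<Longrightarrow> \<bar>u (\<sigma> 1) - u (\<sigma> 0)\<bar> \<le> C' * l ^ DIM('a)"
            using ctrl by blast
          \<comment> \<open>The curve \<open>\<psi> \<circ> \<sigma>\<close> has speed at most
            \<open>K * l\<close>. Taking \<open>K \<ge> 1\<close> lets the bound C * l^(n+1) be
            weakened to C * (K * l)^(n+1), which the control at speed \<open>K * l\<close> asks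
            for.\<close>
          define K where "K = max \<kappa> 1"
          have K: "K \<ge> 1" by (simp add: K_def)
          have "\<bar>(u \<circ> \<psi>) (\<sigma> 1) - (u \<circ> \<psi>) (\<sigma> 0)\<bar> \<le> (C' * K ^ DIM('a)) * l ^ DIM('a)"
            if l: "0 \<le> l" and cv: "curve_in (V \<inter> coordinate_subspace ?J) l \<sigma>" and s0: "\<sigma> 0 \<in> A'"
              and bd: "\<forall>t\<in>{0..1}. \<forall>f\<in>?F. \<bar>f (\<sigma> t)\<bar> \<le> C * l ^ Suc n" for \<sigma> l
          proof -
            have "curve_in (S \<inter> ?V) (K * l) (\<psi> \<circ> \<sigma>)"
            proof (rule curve_in_image[OF cv l \<psi>sub])
              fix x assume x: "x \<in> V \<inter> coordinate_subspace ?J"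
              show "(\<psi> has_derivative frechet_derivative \<psi> (at x)) (at x)"
                using Cns_on_Suc_has_derivative[OF \<psi>] x by blast
              fix v
              have "norm (frechet_derivative \<psi> (at x) v) \<le> \<kappa> * norm v" using \<kappa>(2) x by blast
              also have "\<dots> \<le> K * norm v" by (intro mult_right_mono) (auto simp: K_def)
              finally show "norm (frechet_derivative \<psi> (at x) v) \<le> K * norm v" .
            qed (use K in simp)
            moreover have "\<bar>f ((\<psi> \<circ> \<sigma>) t)\<bar> \<le> C * (K * l) ^ Suc n" if t: "t \<in> {0..1}" and f: "f \<in> F" for t f
            proof -
              have "\<bar>f ((\<psi> \<circ> \<sigma>) t)\<bar> \<le> C * l ^ Suc n" using bd t f by (auto simp del: power_Suc)
              also have "\<dots> \<le> C * (K * l) ^ Suc n"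
                using C l K mult_right_mono[of 1 K l] by (intro mult_left_mono power_mono) auto
              finally show ?thesis .
            qed
            moreover have "(\<psi> \<circ> \<sigma>) 0 \<in> A" using s0 \<psi>\<Phi> by (auto simp: A'_def)
            ultimately have "\<bar>u ((\<psi> \<circ> \<sigma>) 1) - u ((\<psi> \<circ> \<sigma>) 0)\<bar> \<le> C' * (K * l) ^ DIM('a)"
              using l K by (intro C'[of "K * l" "\<psi> \<circ> \<sigma>"]) auto
            then show ?thesis by (simp add: power_mult_distrib mult.assoc)
          qed
          then show "\<exists>C'. \<forall>\<sigma> l. 0 \<le> l \<longrightarrow> curve_in (V \<inter> coordinate_subspace ?J) l \<sigma> \<longrightarrow> \<sigma> 0 \<in> A' \<longrightarrow>
            (\<forall>t\<in>{0..1}. \<forall>f\<in>?F. \<bar>f (\<sigma> t)\<bar> \<le> C * l ^ Suc n) \<longrightarrow>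
            \<bar>(u \<circ> \<psi>) (\<sigma> 1) - (u \<circ> \<psi>) (\<sigma> 0)\<bar> \<le> C' * l ^ DIM('a)"
            by blast
        qed
      qed (use UV(4) J j A'sub F(1) in auto)
      moreover have "(u \<circ> \<psi>) ` A' = u ` (A \<inter> U)"
        unfolding A'_def image_image o_def by (intro image_cong refl) (simp add: \<psi>\<Phi>)
      ultimately have "negligible (u ` (A \<inter> U))" by simp
      then have "negligible (u ` ((A - A0) \<inter> U))" by (rule negligible_subset) auto
      then show "\<exists>U. open U \<and> a \<in> U \<and> negligible (u ` ((A - A0) \<inter> U))"
        using UV by blast
    qed
    have "u ` A \<subseteq> u ` A0 \<union> u ` (A - A0)" by auto
    then show ?thesis by (rule negligible_subset[OF negligible_Un[OF neg0 neg1]])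
  qed
qed

theorem negligible_critical_values:
  fixes h :: "'a::euclidean_space \<Rightarrow> real"
  assumes S: "open S" and h: "Cns_on (DIM('a) - 1) 1 S h"
    and A: "A \<subseteq> S" and crit: "\<And>x. x \<in> A \<Longrightarrow> (h has_derivative (\<lambda>_. 0)) (at x)"
  shows "negligible (h ` A)"
proof (cases "DIM('a) = 1")
  case True
  show ?thesis
  proof (rule negligible_image_locally)
    fix a assume "a \<in> A"
    have "negligible (h ` (A \<inter> ball a 1))"
    proof (rule negligible_image_little_o_DIM)
      show "bounded (A \<inter> ball a 1)" by (rule bounded_subset[OF bounded_ball]) auto
      fix x and e :: real assume "x \<in> A \<inter> ball a 1" "e > 0"
      then obtain d where "d > 0" "\<And>y. norm (y - x) < d \<Longrightarrow> norm (h y - h x - 0) \<le> e * norm (y - x)"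
        using crit[of x] unfolding has_derivative_at_alt by blast
      then show "\<exists>\<delta>>0. \<forall>y\<in>A \<inter> ball a 1. norm (y - x) < \<delta> \<longrightarrow> \<bar>h y - h x\<bar> \<le> e * norm (y - x) ^ DIM('a)"
        using True by auto
    qed
    then show "\<exists>U. open U \<and> a \<in> U \<and> negligible (h ` (A \<inter> U))"
      by (intro exI[of _ "ball a 1"]) auto
  qed
next
  case False
  have "DIM('a) > 0" by simp
  then have dim: "DIM('a) \<ge> 2" using False by linarith
  define n where "n = DIM('a) - 2"
  have dn: "DIM('a) = Suc (Suc n)" using dim by (simp add: n_def)
  have hn: "Cns_on (Suc n) 1 S h" using h dn by simp
  let ?F = "(\<lambda>b x. frechet_derivative h (at x) b) ` Basis"
  \<comment> \<open>The whole critical set in \<open>S\<close> takes the place of \<open>A\<close>: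
    it is cut out by continuous functions and so measurable, while \<open>A\<close> is
    arbitrary.\<close>
  define A1 where "A1 = {x\<in>S. \<forall>f\<in>?F. f x = 0}"
  have hD: "(h has_derivative frechet_derivative h (at x)) (at x)" if "x \<in> S" for x
    using Cns_on_Suc_has_derivative[OF hn that] .
  have Fn: "Cns_on n 1 S f" if "f \<in> ?F" for f using hn that by auto
  have "negligible (h ` A1)"
  proof (rule negligible_image_vanishing[OF dim S, of "{}" A1 ?F n])
    show "A1 \<in> sets lebesgue"
      unfolding A1_def by (rule sets_lebesgue_Int_zeros[OF _ S _ Cns_on_continuous[OF Fn]]) (use S in auto)
    show "vanishing_control h ?F n DIM('a) A1 (S \<inter> coordinate_subspace {})"
      unfolding vanishing_control_def
    proof (intro allI impI)
      fix C :: real assume C: "C \<ge> 0"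
      have "\<bar>h (\<sigma> 1) - h (\<sigma> 0)\<bar> \<le> (real DIM('a) * C) * l ^ DIM('a)"
        if l: "0 \<le> l" and cv: "curve_in (S \<inter> coordinate_subspace {}) l \<sigma>"
          and bd: "\<forall>t\<in>{0..1}. \<forall>f\<in>?F. \<bar>f (\<sigma> t)\<bar> \<le> C * l ^ Suc n" for \<sigma> l
      proof -
        have "\<bar>h (\<sigma> 1) - h (\<sigma> 0)\<bar> \<le> real DIM('a) * (C * l ^ Suc n) * l"
          by (rule curve_increment[OF cv _ hD l]) (use bd C l in \<open>auto simp del: power_Suc\<close>)
        then show ?thesis by (simp add: dn ac_simps)
      qed
      then show "\<exists>C'. \<forall>\<sigma> l. 0 \<le> l \<longrightarrow> curve_in (S \<inter> coordinate_subspace {}) l \<sigma> \<longrightarrow> \<sigma> 0 \<in> A1 \<longrightarrow>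
        (\<forall>t\<in>{0..1}. \<forall>f\<in>?F. \<bar>f (\<sigma> t)\<bar> \<le> C * l ^ Suc n) \<longrightarrow> \<bar>h (\<sigma> 1) - h (\<sigma> 0)\<bar> \<le> C' * l ^ DIM('a)"
        by blast
    qed
  qed (use Fn in \<open>auto simp: A1_def coordinate_subspace_def\<close>)
  moreover have "A \<subseteq> A1"
  proof
    fix x assume x: "x \<in> A"
    have "frechet_derivative h (at x) = (\<lambda>_. 0)" by (rule frechet_derivative_at[OF crit[OF x], symmetric])
    then show "x \<in> A1" using A x by (auto simp: A1_def)
  qed
  then have "h ` A \<subseteq> h ` A1" by (rule image_mono)
  ultimately show ?thesis by (rule negligible_subset)
qed

section \<open>Critical points from invariance\<close>

text \<open>The second difference is symmetric in \<open>v\<close> and \<open>w\<close>. The mean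
  value theorem, first in direction \<open>v\<close> for the difference in direction
  \<open>w\<close> and then in direction \<open>w\<close>, turns it into \<open>s\<^sup>2\<close>
  times the mixed derivative at a nearby point. Exchanging \<open>v\<close> and \<open>w\<close>
  will give the symmetry of second derivatives.\<close>

lemma second_difference_approx:
  fixes f :: "'a::euclidean_space \<Rightarrow> real"
  assumes S: "open S" and f: "Cn_on 2 S f" and x: "x \<in> S" and \<epsilon>: "\<epsilon> > 0"
  shows "\<exists>\<delta>>0. \<forall>s. 0 < s \<longrightarrow> s < \<delta> \<longrightarrow>
    \<bar>f (x + s *\<^sub>R v + s *\<^sub>R w) - f (x + s *\<^sub>R v) - f (x + s *\<^sub>R w) + f x
      - s\<^sup>2 * frechet_derivative (\<lambda>y. frechet_derivative f (at y) v) (at x) w\<bar> \<le> \<epsilon> * s\<^sup>2"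
proof -
  let ?D = "\<lambda>y. frechet_derivative f (at y) v"
  let ?D2 = "\<lambda>y. frechet_derivative ?D (at y) w"
  have fd: "(f has_derivative frechet_derivative f (at y)) (at y)" if "y \<in> S" for y
    using f that frechet_derivative_works unfolding numeral_2_eq_2 by auto
  have Dd: "(?D has_derivative frechet_derivative ?D (at y)) (at y)" if "y \<in> S" for y
    using f that unfolding numeral_2_eq_2 by (simp add: frechet_derivative_works[symmetric])
  have "continuous_on S ?D2" using f unfolding numeral_2_eq_2 by auto
  then obtain r1 where r1: "r1 > 0" "\<And>y. y \<in> S \<Longrightarrow> dist y x < r1 \<Longrightarrow> dist (?D2 y) (?D2 x) < \<epsilon>"
    using x \<epsilon> unfolding continuous_on_iff by blast
  obtain r2 where r2: "r2 > 0" "ball x r2 \<subseteq> S" using S x openE by blast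
  define r where "r = min r1 r2"
  have r: "r > 0" "\<And>y. y \<in> ball x r \<Longrightarrow> y \<in> S" "\<And>y. y \<in> ball x r \<Longrightarrow> \<bar>?D2 y - ?D2 x\<bar> \<le> \<epsilon>"
    using r1 r2 by (force simp: r_def dist_commute dist_real_def subset_eq)+
  \<comment> \<open>For \<open>s < r / n\<close> the whole parallelogram spanned by
    \<open>s *\<^sub>R v\<close> and \<open>s *\<^sub>R w\<close> at \<open>x\<close> stays in the
    ball; the summand 1 keeps \<open>n\<close> positive if both vectors are zero.\<close>
  define n where "n = norm v + norm w + 1"
  have n: "n > 0" unfolding n_def by (smt (verit) norm_ge_zero)
  define \<delta> where "\<delta> = r / n"
  show ?thesis
  proof (intro exI[of _ \<delta>] conjI allI impI)
    show "\<delta> > 0" using r n by (simp add: \<delta>_def)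
    fix s :: real assume s: "0 < s" "s < \<delta>"
    have inb: "x + p *\<^sub>R v + q *\<^sub>R w \<in> ball x r" if "0 \<le> p" "p \<le> s" "0 \<le> q" "q \<le> s" for p q
    proof -
      have "norm (p *\<^sub>R v + q *\<^sub>R w) \<le> p * norm v + q * norm w"
        using that norm_triangle_ineq[of "p *\<^sub>R v" "q *\<^sub>R w"] by simp
      also have "\<dots> \<le> s * norm v + s * norm w" using that by (intro add_mono mult_right_mono) auto
      also have "\<dots> < s * n" using s by (simp add: n_def algebra_simps)
      also have "\<dots> < r" using s n by (simp add: \<delta>_def less_divide_eq)
      finally show ?thesis by (simp add: dist_norm norm_minus_commute add.assoc add.commute)
    qed
    define g where "g t = f (x + t *\<^sub>R v + s *\<^sub>R w) - f (x + t *\<^sub>R v)" for t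
    have g': "(g has_real_derivative ?D (x + t *\<^sub>R v + s *\<^sub>R w) - ?D (x + t *\<^sub>R v)) (at t)"
      if t: "0 \<le> t" "t \<le> s" for t
    proof -
      have d: "((\<lambda>t. f (x + t *\<^sub>R v + z)) has_real_derivative ?D (x + t *\<^sub>R v + z)) (at t)"
        if "x + t *\<^sub>R v + z \<in> S" for z
      proof -
        have "((\<lambda>t. x + t *\<^sub>R v + z) has_vector_derivative v) (at t)"
          by (auto intro!: derivative_eq_intros)
        from vector_derivative_diff_chain_within[OF this has_derivative_at_withinI[OF fd[OF that]]]
        show ?thesis by (simp add: o_def has_real_derivative_iff_has_vector_derivative)
      qed
      have "x + t *\<^sub>R v + s *\<^sub>R w \<in> S" "x + t *\<^sub>R v + 0 \<in> S"
        using inb[of t s] inb[of t 0] t s r(2) by auto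
      from DERIV_diff[OF d[OF this(1)] d[OF this(2)]] show ?thesis by (simp add: g_def[abs_def])
    qed
    obtain p where p: "0 < p" "p < s"
      and gp: "g s - g 0 = (s - 0) * (?D (x + p *\<^sub>R v + s *\<^sub>R w) - ?D (x + p *\<^sub>R v))"
      using MVT2[OF s(1) g'] by auto
    define k where "k t = ?D (x + p *\<^sub>R v + t *\<^sub>R w)" for t
    have k': "(k has_real_derivative ?D2 (x + p *\<^sub>R v + t *\<^sub>R w)) (at t)" if t: "0 \<le> t" "t \<le> s" for t
    proof -
      have inS: "x + p *\<^sub>R v + t *\<^sub>R w \<in> S" using inb[of p t] t p r(2) by auto
      have curve: "((\<lambda>t. x + p *\<^sub>R v + t *\<^sub>R w) has_vector_derivative w) (at t)"
        by (auto intro!: derivative_eq_intros)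
      have "(?D \<circ> (\<lambda>t. x + p *\<^sub>R v + t *\<^sub>R w) has_vector_derivative ?D2 (x + p *\<^sub>R v + t *\<^sub>R w)) (at t)"
        by (rule vector_derivative_diff_chain_within[OF curve has_derivative_at_withinI[OF Dd[OF inS]]])
      then show ?thesis by (simp add: o_def k_def[abs_def] has_real_derivative_iff_has_vector_derivative)
    qed
    obtain q where q: "0 < q" "q < s" and kq: "k s - k 0 = (s - 0) * ?D2 (x + p *\<^sub>R v + q *\<^sub>R w)"
      using MVT2[OF s(1) k'] by auto
    have "f (x + s *\<^sub>R v + s *\<^sub>R w) - f (x + s *\<^sub>R v) - f (x + s *\<^sub>R w) + f x = g s - g 0"
      by (simp add: g_def)
    also have "\<dots> = s * (k s - k 0)" using gp by (simp add: k_def)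
    also have "\<dots> = s\<^sup>2 * ?D2 (x + p *\<^sub>R v + q *\<^sub>R w)" using kq by (simp add: power2_eq_square)
    finally have eq: "f (x + s *\<^sub>R v + s *\<^sub>R w) - f (x + s *\<^sub>R v) - f (x + s *\<^sub>R w) + f x
      - s\<^sup>2 * ?D2 x = s\<^sup>2 * (?D2 (x + p *\<^sub>R v + q *\<^sub>R w) - ?D2 x)"
      by (simp add: algebra_simps)
    have "\<bar>?D2 (x + p *\<^sub>R v + q *\<^sub>R w) - ?D2 x\<bar> \<le> \<epsilon>" using r(3) inb[of p q] p q by auto
    then show "\<bar>f (x + s *\<^sub>R v + s *\<^sub>R w) - f (x + s *\<^sub>R v) - f (x + s *\<^sub>R w) + f x - s\<^sup>2 * ?D2 x\<bar> \<le> \<epsilon> * s\<^sup>2"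
      unfolding eq abs_mult using mult_left_mono[of _ \<epsilon> "s\<^sup>2"] by (simp add: mult.commute[of \<epsilon>])
  qed
qed

lemma symmetric_second_derivative:
  fixes f :: "'a::euclidean_space \<Rightarrow> real"
  assumes S: "open S" "Cn_on 2 S f" "x \<in> S"
  shows "frechet_derivative (\<lambda>y. frechet_derivative f (at y) v) (at x) w =
         frechet_derivative (\<lambda>y. frechet_derivative f (at y) w) (at x) v" (is "?a = ?b")
proof (rule ccontr)
  assume "?a \<noteq> ?b"
  \<comment> \<open>A third of the gap: the two approximation errors account for at most two thirds
    of it, a contradiction.\<close>
  define \<epsilon> where "\<epsilon> = \<bar>?a - ?b\<bar> / 3"
  have \<epsilon>: "\<epsilon> > 0" using \<open>?a \<noteq> ?b\<close> by (simp add: \<epsilon>_def)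
  let ?\<Delta> = "\<lambda>v w s. f (x + s *\<^sub>R v + s *\<^sub>R w) - f (x + s *\<^sub>R v) - f (x + s *\<^sub>R w) + f x"
  obtain \<delta>1 where \<delta>1: "\<delta>1 > 0" "\<And>s. 0 < s \<Longrightarrow> s < \<delta>1 \<Longrightarrow> \<bar>?\<Delta> v w s - s\<^sup>2 * ?a\<bar> \<le> \<epsilon> * s\<^sup>2"
    using second_difference_approx[OF S \<epsilon>, of v w] by blast
  obtain \<delta>2 where \<delta>2: "\<delta>2 > 0" "\<And>s. 0 < s \<Longrightarrow> s < \<delta>2 \<Longrightarrow> \<bar>?\<Delta> w v s - s\<^sup>2 * ?b\<bar> \<le> \<epsilon> * s\<^sup>2"
    using second_difference_approx[OF S \<epsilon>, of w v] by blast
  define s where "s = min \<delta>1 \<delta>2 / 2"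
  have s: "0 < s" "s < \<delta>1" "s < \<delta>2" using \<delta>1(1) \<delta>2(1) by (auto simp: s_def)
  have sym: "?\<Delta> v w s = ?\<Delta> w v s" by (simp add: algebra_simps)
  have "s\<^sup>2 * \<bar>?a - ?b\<bar> = \<bar>s\<^sup>2 * ?a - s\<^sup>2 * ?b\<bar>"
    by (simp add: abs_mult right_diff_distrib[symmetric])
  also have "\<dots> \<le> 2 * (\<epsilon> * s\<^sup>2)" using \<delta>1(2)[OF s(1,2)] \<delta>2(2)[OF s(1,3)] sym by linarith
  also have "\<dots> = s\<^sup>2 * (2 * \<epsilon>)" by simp
  finally have "\<bar>?a - ?b\<bar> \<le> 2 * \<epsilon>" using s(1) by simp
  then show False using \<epsilon> by (simp add: \<epsilon>_def)
qed

text \<open>The Hamiltonian vector is tangent to the graph at this point, and the tangent space is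
  Lagrangian because \<open>DG\<close> is symmetric; so dH, the symplectic pairing with that vector,
  vanishes on the tangent space. In coordinates, the velocity \<open>(X, Y)\<close> satisfies
  \<open>Y = DG X\<close>, and
  \<open>DH (v, DG v) = - (DG X \<bullet> v) + DG v \<bullet> X = 0\<close>.\<close>

lemma hamiltonian_graph_critical:
  fixes Ht :: "(real ^ 'd) \<times> (real ^ 'd) \<Rightarrow> real" and G :: "real ^ 'd \<Rightarrow> real ^ 'd"
  assumes H: "(Ht has_derivative DH) (at (x0, G x0))" and G: "(G has_derivative DG) (at x0)"
    and sym: "\<And>v w. DG v \<bullet> w = DG w \<bullet> v"
    and y: "(y has_vector_derivative ((\<chi> i. DH (0, axis i 1)), - (\<chi> i. DH (axis i 1, 0)))) (at t0)"
    and y0: "y t0 = (x0, G x0)" and ev: "\<forall>\<^sub>F t in nhds t0. snd (y t) = G (fst (y t))"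
  shows "((\<lambda>x. Ht (x, G x)) has_derivative (\<lambda>_. 0)) (at x0)"
proof -
  interpret DH: bounded_linear DH using H has_derivative_bounded_linear by blast
  define X where "X = (\<chi> i. DH (0, axis i 1))"
  define Y where "Y = - (\<chi> i. DH (axis i 1, 0))"
  have exp: "v = (\<Sum>i\<in>UNIV. (v $ i) *\<^sub>R axis i 1)" for v :: "real ^ 'd"
    by (metis (no_types, lifting) basis_expansion scalar_mult_eq_scaleR sum.cong)
  have DX: "DH (0, w) = X \<bullet> w" for w
  proof -
    have "(0::real^'d, w) = (\<Sum>i\<in>UNIV. (w $ i) *\<^sub>R (0, axis i 1))"
      by (simp add: prod_eq_iff fst_sum snd_sum exp[symmetric])
    then have "DH (0, w) = DH (\<Sum>i\<in>UNIV. (w $ i) *\<^sub>R (0, axis i 1))" by simp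
    also have "\<dots> = (\<Sum>i\<in>UNIV. (w $ i) * DH (0, axis i 1))" by (simp only: DH.sum DH.scaleR real_scaleR_def)
    finally show ?thesis by (simp add: X_def inner_vec_def mult.commute)
  qed
  have DY: "DH (v, 0) = - (Y \<bullet> v)" for v
  proof -
    have "(v, 0::real^'d) = (\<Sum>i\<in>UNIV. (v $ i) *\<^sub>R (axis i 1, 0))"
      by (simp add: prod_eq_iff fst_sum snd_sum exp[symmetric])
    then have "DH (v, 0) = DH (\<Sum>i\<in>UNIV. (v $ i) *\<^sub>R (axis i 1, 0))" by simp
    also have "\<dots> = (\<Sum>i\<in>UNIV. (v $ i) * DH (axis i 1, 0))" by (simp only: DH.sum DH.scaleR real_scaleR_def)
    finally show ?thesis by (simp add: Y_def inner_vec_def mult.commute sum_negf)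
  qed
  have yX: "((\<lambda>t. fst (y t)) has_vector_derivative X) (at t0)"
    using bounded_linear.has_vector_derivative[OF bounded_linear_fst y] by (simp add: X_def)
  have yY: "((\<lambda>t. snd (y t)) has_vector_derivative Y) (at t0)"
    using bounded_linear.has_vector_derivative[OF bounded_linear_snd y] by (simp add: Y_def)
  have dG: "(G \<circ> (\<lambda>t. fst (y t)) has_vector_derivative DG X) (at t0)"
    using vector_derivative_diff_chain_within[OF yX, of G DG] G y0 has_derivative_at_withinI by auto
  obtain T where T: "open T" "t0 \<in> T" "\<And>t. t \<in> T \<Longrightarrow> snd (y t) = G (fst (y t))"
    using ev unfolding eventually_nhds by blast
  have "((\<lambda>t. snd (y t)) has_vector_derivative DG X) (at t0)"
    by (rule has_vector_derivative_transform_within_open[OF dG T(1,2)]) (simp add: T(3))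
  then have YX: "Y = DG X" using yY vector_derivative_unique_at by blast
  have "((\<lambda>x. Ht (x, G x)) has_derivative (\<lambda>v. DH (v, DG v))) (at x0)"
    using has_derivative_compose[OF has_derivative_Pair[OF has_derivative_ident G] H] by simp
  moreover have "DH (v, DG v) = 0" for v
  proof -
    have "DH (v, DG v) = DH (v, 0) + DH (0, DG v)" by (simp add: DH.add[symmetric])
    also have "\<dots> = - (DG X \<bullet> v) + DG v \<bullet> X" by (simp add: DX DY YX inner_commute)
    also have "\<dots> = 0" by (simp add: sym[of X v])
    finally show ?thesis .
  qed
  ultimately show ?thesis by simp
qed

section \<open>Invariant sets in the cotangent bundle\<close>

lemma continuous_on_open_vimage_Collect:
  assumes "continuous_on S f" "open S" "open T"
  shows "open {x\<in>S. f x \<in> T}"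
proof -
  have "{x\<in>S. f x \<in> T} = S \<inter> f -` T" by auto
  then show ?thesis using continuous_open_preimage[OF assms] by simp
qed

lemma constant_on_negligible_connected_image:
  fixes f :: "'a \<Rightarrow> real"
  assumes "connected (f ` X)" "negligible (f ` X)"
  shows "f constant_on X"
proof (rule ccontr)
  assume "\<not> f constant_on X"
  then obtain x y where "x \<in> X" "y \<in> X" "f x < f y"
    unfolding constant_on_def by (metis linorder_neqE)
  then have "{f x..f y} \<subseteq> f ` X" using connected_contains_Icc[OF assms(1)] by blast
  then have "negligible {f x..f y}" using assms(2) negligible_subset by blast
  then show False using negligible_interval(1)[of "f x" "f y"] \<open>f x < f y\<close> by simp
qed

context
  fixes M :: "'a topology" and A :: "('a, 'd::finite) chart set"
  assumes at: "smooth_atlas M A"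
begin

section \<open>Canonical charts of the cotangent bundle\<close>

lemma cinv_cmap:
  assumes "c \<in> A" "q \<in> cdom c"
  shows "cinv c (cmap c q) = q"
proof -
  have "inj_on (cmap c) (cdom c)" using at assms(1) chart_inj_on unfolding smooth_atlas_def by blast
  then show ?thesis using assms(2) unfolding cinv_def by (rule inv_into_f_f)
qed

lemma open_cran: "c \<in> A \<Longrightarrow> open (cran c)"
  using at unfolding smooth_atlas_def is_chart_def by blast

lemma cot_inv_mem: "c \<in> A \<Longrightarrow> y \<in> cran c \<times> UNIV \<Longrightarrow> cot_inv M A c y \<in> cot_dom M A c"
  unfolding cot_inv_def by (rule inv_into_into) (simp add: bij_betw_imp_surj_on[OF bij_betw_cot_chart[OF at]])

lemma cot_chart_cot_inv: "c \<in> A \<Longrightarrow> y \<in> cran c \<times> UNIV \<Longrightarrow> cot_chart c (cot_inv M A c y) = y"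
  unfolding cot_inv_def by (rule f_inv_into_f) (simp add: bij_betw_imp_surj_on[OF bij_betw_cot_chart[OF at]])

lemma cot_inv_cot_chart: "c \<in> A \<Longrightarrow> z \<in> cot_dom M A c \<Longrightarrow> cot_inv M A c (cot_chart c z) = z"
  unfolding cot_inv_def by (rule inv_into_f_f[OF bij_betw_imp_inj_on[OF bij_betw_cot_chart[OF at]]])

text \<open>This makes continuity in the cotangent topology usable: an integral curve that lies over
  the domain of \<open>c\<close> at one time does so at all nearby times. Seen in another chart, the
  set is the coordinate image of the overlap times all momenta.\<close>

lemma openin_cot_dom:
  assumes c: "c \<in> A"
  shows "openin (cotangent_topology M A) (cot_dom M A c)"
  unfolding openin_cotangent_topology
proof (intro conjI ballI)
  show "cot_dom M A c \<subseteq> cotangent_bundle M A" by (auto simp: cot_dom_def)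
  fix c' assume c': "c' \<in> A"
  have chart: "is_chart M c" "is_chart M c'" using at c c' unfolding smooth_atlas_def by blast+
  let ?W = "cmap c' ` (cdom c \<inter> cdom c')"
  have "(cran c' \<times> UNIV) \<inter> cot_inv M A c' -` cot_dom M A c = ?W \<times> UNIV"
  proof (rule set_eqI)
    fix y :: "(real ^ 'd) \<times> (real ^ 'd)"
    show "y \<in> (cran c' \<times> UNIV) \<inter> cot_inv M A c' -` cot_dom M A c \<longleftrightarrow> y \<in> ?W \<times> UNIV"
    proof (cases "y \<in> cran c' \<times> UNIV")
      case True
      let ?z = "cot_inv M A c' y"
      have z: "?z \<in> cot_dom M A c'" "cot_chart c' ?z = y"
        using cot_inv_mem[OF c' True] cot_chart_cot_inv[OF c' True] by auto
      have zc: "fst ?z \<in> cdom c'" "?z \<in> cotangent_bundle M A" using z(1) by (auto simp: cot_dom_def)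
      have y1: "cmap c' (fst ?z) = fst y" using z(2) unfolding cot_chart_def by (metis fst_conv)
      have "?z \<in> cot_dom M A c \<longleftrightarrow> fst ?z \<in> cdom c" using zc by (simp add: cot_dom_def)
      also have "\<dots> \<longleftrightarrow> fst y \<in> ?W"
      proof
        assume "fst ?z \<in> cdom c"
        then show "fst y \<in> ?W" using y1 zc(1) by (metis IntI imageI)
      next
        assume "fst y \<in> ?W"
        then obtain q where q: "q \<in> cdom c" "q \<in> cdom c'" "fst y = cmap c' q" by blast
        then have "q = fst ?z" using cinv_cmap[OF c'] y1 zc(1) by metis
        then show "fst ?z \<in> cdom c" using q by simp
      qed
      finally show ?thesis using True by (auto simp: mem_Times_iff)
    next
      case False
      then show ?thesis by (auto simp: mem_Times_iff)
    qed
  qed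
  moreover have "open (?W \<times> (UNIV :: (real ^ 'd) set))"
    using open_chart_image[OF chart(2)] chart(1) unfolding is_chart_def by (intro open_Times) auto
  ultimately show "open ((cran c' \<times> UNIV) \<inter> cot_inv M A c' -` cot_dom M A c)" by simp
qed

lemma topspace_cotangent_topology: "topspace (cotangent_topology M A) = cotangent_bundle M A"
proof
  show "topspace (cotangent_topology M A) \<subseteq> cotangent_bundle M A"
    using openin_topspace openin_cotangent_topology by metis
  show "cotangent_bundle M A \<subseteq> topspace (cotangent_topology M A)"
  proof
    fix z assume z: "z \<in> cotangent_bundle M A"
    then have "fst z \<in> topspace M" by (auto simp: cotangent_bundle_def)
    then obtain c where "c \<in> A" "fst z \<in> cdom c" using at unfolding smooth_atlas_def by blast
    then have "z \<in> cot_dom M A c" "openin (cotangent_topology M A) (cot_dom M A c)"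
      using z openin_cot_dom by (auto simp: cot_dom_def)
    then show "z \<in> topspace (cotangent_topology M A)" using openin_subset by blast
  qed
qed

lemma continuous_map_hamiltonian:
  assumes "1 \<le> r" "Cr_hamiltonian r M A H"
  shows "continuous_map (cotangent_topology M A) euclideanreal H"
  unfolding continuous_map_def
proof (intro conjI allI impI)
  fix U :: "real set" assume "openin euclideanreal U"
  then have U: "open U" by simp
  let ?W = "{z \<in> topspace (cotangent_topology M A). H z \<in> U}"
  show "openin (cotangent_topology M A) ?W"
    unfolding openin_cotangent_topology
  proof (intro conjI ballI)
    show "?W \<subseteq> cotangent_bundle M A" by (auto simp: topspace_cotangent_topology)
    fix c assume c: "c \<in> A"
    have "Cn_on 0 (cran c \<times> UNIV) (H \<circ> cot_inv M A c)"
      using assms(2) c zero_le[of r] unfolding Cr_hamiltonian_def Cr_on_def zero_enat_def by blast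
    then have "continuous_on (cran c \<times> UNIV) (H \<circ> cot_inv M A c)" by simp
    then have "open {y \<in> cran c \<times> UNIV. (H \<circ> cot_inv M A c) y \<in> U}"
      using open_cran[OF c] U by (intro continuous_on_open_vimage_Collect open_Times) auto
    also have "{y \<in> cran c \<times> UNIV. (H \<circ> cot_inv M A c) y \<in> U} = (cran c \<times> UNIV) \<inter> cot_inv M A c -` ?W"
      using cot_inv_mem[OF c] unfolding topspace_cotangent_topology cot_dom_def by auto
    finally show "open ((cran c \<times> UNIV) \<inter> cot_inv M A c -` ?W)" .
  qed
qed auto

section \<open>Closed forms, invariant sets and critical points\<close>

text \<open>Near \<open>q\<close> the form is the differential of a C^2 function, so in the chart
  \<open>DG\<close> is the Hessian of that function.\<close>

lemma closed_form_derivative_symmetric: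
  assumes "closed_form M A \<Gamma>" "c \<in> A" "q \<in> cdom c"
    and G: "((\<lambda>x. \<Gamma> (cinv c x) c) has_derivative DG) (at (cmap c q))"
  shows "DG v \<bullet> w = DG w \<bullet> v"
proof -
  have chart: "is_chart M c" using at assms(2) unfolding smooth_atlas_def by blast
  have "q \<in> topspace M" using at assms(2,3) unfolding smooth_atlas_def by blast
  then have "\<exists>V f. openin M V \<and> q \<in> V \<and> Cr_fun_on 2 A V f \<and> (\<forall>x\<in>V. \<Gamma> x = differential A f x)"
    using assms(1) unfolding closed_form_def by (rule bspec[rotated])
  then obtain V f where V: "openin M V" "q \<in> V" and f: "Cr_fun_on 2 A V f"
    and \<Gamma>: "\<And>x. x \<in> V \<Longrightarrow> \<Gamma> x = differential A f x"
    by (elim exE conjE) (rule that, auto)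
  define W where "W = cmap c ` (V \<inter> cdom c)"
  define F where "F = f \<circ> cinv c"
  let ?D = "\<lambda>v y. frechet_derivative F (at y) v"
  have W: "open W" "cmap c q \<in> W" using open_chart_image[OF chart V(1)] V(2) assms(3) by (auto simp: W_def)
  have F2: "Cn_on 2 W F"
    using f assms(2) unfolding Cr_fun_on_def Cr_on_def W_def F_def by (metis numeral_eq_enat order_refl)
  have G_eq: "\<Gamma> (cinv c y) c \<bullet> v = ?D v y" if y: "y \<in> W" for y v
  proof -
    obtain x where x: "x \<in> V" "x \<in> cdom c" "y = cmap c x" using y by (auto simp: W_def)
    have "F differentiable (at y)" using F2 y unfolding numeral_2_eq_2 by simp
    then interpret linear "frechet_derivative F (at y)" by (rule linear_frechet_derivative)
    have ci: "cinv c y = x" using cinv_cmap[OF assms(2) x(2)] x(3) by simp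
    have "\<Gamma> (cinv c y) c = (\<chi> i. ?D (axis i 1) y)"
      using \<Gamma>[OF x(1)] x(2) assms(2) unfolding ci by (simp add: differential_def F_def x(3))
    then have "\<Gamma> (cinv c y) c \<bullet> v = (\<Sum>i\<in>UNIV. v $ i * ?D (axis i 1) y)"
      by (simp add: inner_vec_def mult.commute)
    also have "\<dots> = ?D (\<Sum>i\<in>UNIV. (v $ i) *\<^sub>R axis i 1) y" by (simp add: sum scaleR)
    also have "(\<Sum>i\<in>UNIV. (v $ i) *\<^sub>R axis i 1) = v"
      by (metis (no_types, lifting) basis_expansion scalar_mult_eq_scaleR sum.cong)
    finally show ?thesis .
  qed
  have "DG w \<bullet> v = frechet_derivative (?D v) (at (cmap c q)) w" for v w
  proof -
    have "((\<lambda>x. \<Gamma> (cinv c x) c \<bullet> v) has_derivative (\<lambda>w. DG w \<bullet> v)) (at (cmap c q))"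
      using bounded_linear.has_derivative[OF bounded_linear_inner_left G] .
    then have "(?D v has_derivative (\<lambda>w. DG w \<bullet> v)) (at (cmap c q))"
      by (rule has_derivative_transform_within_open[OF _ W]) (rule G_eq)
    from frechet_derivative_at[OF this] show ?thesis by metis
  qed
  then show ?thesis using symmetric_second_derivative[OF W(1) F2 W(2)] by simp
qed

text \<open>For \<open>2 \<le> r\<close>, invariance at time 0 yields a complete integral curve
  through \<open>z\<close>, and invariance at every time keeps this curve in
  \<open>\<Lambda>\<close>. Both readings of invariance thus provide the one curve that the critical
  point argument uses.\<close>

lemma flow_invariant_integral_curve:
  assumes "flow_invariant r M A H \<Lambda>" "z \<in> \<Lambda>"
  obtains \<gamma> t where "integral_curve M A H \<gamma>" "\<gamma> t = z" "range \<gamma> \<subseteq> \<Lambda>"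
proof (cases "2 \<le> r")
  case True
  then have inv: "ham_flow M A H t `` \<Lambda> = \<Lambda>" for t using assms(1) by (simp add: flow_invariant_def)
  have "z \<in> ham_flow M A H 0 `` \<Lambda>" using inv[of 0] assms(2) by simp
  then obtain \<gamma> where \<gamma>: "integral_curve M A H \<gamma>" "\<gamma> 0 = z" "\<gamma> 0 \<in> \<Lambda>"
    by (auto simp: ham_flow_def)
  have "\<gamma> t \<in> \<Lambda>" for t
  proof -
    have "\<gamma> t \<in> ham_flow M A H t `` \<Lambda>" using \<gamma> unfolding ham_flow_def by blast
    then show ?thesis using inv by simp
  qed
  then show ?thesis using that \<gamma> by blast
next
  case False
  then show ?thesis using assms that unfolding flow_invariant_def by auto
qed

lemma critical_on_invariant_set:
  assumes r: "1 \<le> r" and H: "Cr_hamiltonian r M A H" and \<Gamma>: "C1_lagrangian_section M A \<Gamma>"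
    and sub: "\<Lambda> \<subseteq> graph M \<Gamma>" and inv: "flow_invariant r M A H \<Lambda>"
    and c: "c \<in> A" and q: "(q, p) \<in> \<Lambda>" "q \<in> cdom c"
  shows "(((\<lambda>q. H (q, \<Gamma> q)) \<circ> cinv c) has_derivative (\<lambda>_. 0)) (at (cmap c q))"
proof -
  define G where "G x = \<Gamma> (cinv c x) c" for x
  define x0 where "x0 = cmap c q"
  define y0 where "y0 = (x0, G x0)"
  have x0: "x0 \<in> cran c" using q(2) by (simp add: x0_def)
  have on_graph: "snd z = \<Gamma> (fst z) \<and> fst z \<in> topspace M" if "z \<in> \<Lambda>" for z
    using sub that unfolding graph_def by auto
  have cdomM: "x \<in> topspace M" if "x \<in> cdom c" for x using at c that unfolding smooth_atlas_def by blast
  \<comment> \<open>This identifies the coordinate expression of \<open>h\<close> with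
    \<open>Ht (x, G x)\<close>, the form in which the Euclidean computation applies.\<close>
  have lift: "cot_inv M A c (x, G x) = (cinv c x, \<Gamma> (cinv c x))" if xc: "x \<in> cran c" for x
  proof -
    obtain p where p: "p \<in> cdom c" "x = cmap c p" using xc by blast
    have ci: "cinv c x = p" using cinv_cmap[OF c p(1)] p(2) by simp
    have "(p, \<Gamma> p) \<in> cot_dom M A c"
      using \<Gamma> p cdomM[OF p(1)] unfolding C1_lagrangian_section_def C1_section_def cot_dom_def cotangent_bundle_def by simp
    from cot_inv_cot_chart[OF c this] show ?thesis by (simp add: cot_chart_def G_def ci p(2)[symmetric])
  qed
  have "Cn_on 1 (cran c) G"
    using \<Gamma> c unfolding C1_lagrangian_section_def C1_section_def Cr_on_def G_def by (metis one_enat_def order_refl)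
  then have "G differentiable (at x0)" using x0 unfolding One_nat_def Cn_on.simps by blast
  then obtain DG where DG: "(G has_derivative DG) (at x0)" unfolding differentiable_def by blast
  have sym: "DG v \<bullet> w = DG w \<bullet> v" for v w
    using closed_form_derivative_symmetric[OF _ c q(2), of \<Gamma> DG] \<Gamma> DG
    unfolding C1_lagrangian_section_def G_def x0_def by blast
  define Ht where "Ht = H \<circ> cot_inv M A c"
  have "Cn_on 1 (cran c \<times> UNIV) Ht"
    using H c r unfolding Cr_hamiltonian_def Cr_on_def Ht_def by (metis one_enat_def)
  moreover have "y0 \<in> cran c \<times> UNIV" using x0 by (simp add: y0_def)
  ultimately have "Ht differentiable (at y0)" unfolding One_nat_def Cn_on.simps by blast
  then have DH: "(Ht has_derivative frechet_derivative Ht (at y0)) (at y0)" by (simp add: frechet_derivative_works)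
  obtain \<gamma> t0 where \<gamma>: "integral_curve M A H \<gamma>" "\<gamma> t0 = (q, p)" "range \<gamma> \<subseteq> \<Lambda>"
    using flow_invariant_integral_curve[OF inv q(1)] by metis
  have pG: "p = \<Gamma> q" using on_graph[OF q(1)] by simp
  have y0c: "cot_chart c (\<gamma> t0) = y0"
    using cinv_cmap[OF c q(2)] by (simp add: \<gamma>(2) cot_chart_def y0_def x0_def G_def pG)
  have "((\<lambda>x. Ht (x, G x)) has_derivative (\<lambda>_. 0)) (at x0)"
  proof (rule hamiltonian_graph_critical[where y = "\<lambda>\<tau>. cot_chart c (\<gamma> \<tau>)" and ?t0.0 = t0])
    show "(Ht has_derivative frechet_derivative Ht (at y0)) (at (x0, G x0))" using DH by (simp add: y0_def)
    show "((\<lambda>\<tau>. cot_chart c (\<gamma> \<tau>)) has_vector_derivative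
       ((\<chi> i. frechet_derivative Ht (at y0) (0, axis i 1)), - (\<chi> i. frechet_derivative Ht (at y0) (axis i 1, 0)))) (at t0)"
      using \<gamma>(1)[unfolded integral_curve_def, THEN conjunct2, rule_format, OF c, of t0] q(2)
      by (simp add: \<gamma>(2) y0c[unfolded \<gamma>(2)] ham_field_def Ht_def)
    \<comment> \<open>The times at which the curve lies over the chart form an open set, so around
      \<open>t0\<close> membership in \<open>\<Lambda>\<close> reads as lying on the graph of
      \<open>G\<close> in coordinates.\<close>
    have "openin euclideanreal {\<tau> \<in> topspace euclideanreal. \<gamma> \<tau> \<in> cot_dom M A c}"
      using \<gamma>(1) openin_cot_dom[OF c] unfolding integral_curve_def by (blast intro: openin_continuous_map_preimage)
    then have op: "open {\<tau>. \<gamma> \<tau> \<in> cot_dom M A c}" by simp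
    have "\<gamma> t0 \<in> cot_dom M A c"
      using \<Gamma> on_graph[OF q(1)] q(2)
      unfolding C1_lagrangian_section_def C1_section_def cot_dom_def cotangent_bundle_def \<gamma>(2) by simp
    moreover have "snd (cot_chart c (\<gamma> \<tau>)) = G (fst (cot_chart c (\<gamma> \<tau>)))" if "\<gamma> \<tau> \<in> cot_dom M A c" for \<tau>
    proof -
      have "fst (\<gamma> \<tau>) \<in> cdom c" using that by (simp add: cot_dom_def)
      moreover have "snd (\<gamma> \<tau>) = \<Gamma> (fst (\<gamma> \<tau>))" using on_graph[of "\<gamma> \<tau>"] \<gamma>(3) by blast
      ultimately show ?thesis using cinv_cmap[OF c] by (simp add: cot_chart_def G_def)
    qed
    ultimately show "\<forall>\<^sub>F \<tau> in nhds t0. snd (cot_chart c (\<gamma> \<tau>)) = G (fst (cot_chart c (\<gamma> \<tau>)))"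
      unfolding eventually_nhds using op by (intro exI[of _ "{\<tau>. \<gamma> \<tau> \<in> cot_dom M A c}"]) blast
  qed (use DG sym y0c y0_def in auto)
  moreover have "Ht (x, G x) = ((\<lambda>q. H (q, \<Gamma> q)) \<circ> cinv c) x" if "x \<in> cran c" for x
    by (simp add: Ht_def lift[OF that])
  ultimately show ?thesis
    unfolding x0_def[symmetric] using has_derivative_transform_within_open[OF _ open_cran[OF c] x0] by blast
qed

end

theorem theorem1:
  fixes M :: "'a topology"
    and A :: "('a, 'd::finite) chart set"
    and H :: "'a \<times> ('a, 'd) covector \<Rightarrow> real"
    and r :: enat
    and \<Gamma> :: "'a \<Rightarrow> ('a, 'd) covector"
    and \<Lambda> :: "('a \<times> ('a, 'd) covector) set"
    and h :: "'a \<Rightarrow> real"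
    and d' :: nat
    and s :: real
  assumes "closed_manifold M A"
    and "connected_space M"
    and "1 \<le> r"
    and "Cr_hamiltonian r M A H"
    and "C1_lagrangian_section M A \<Gamma>"
    and "\<Lambda> \<subseteq> graph M \<Gamma>"
    and "compactin (cotangent_topology M A) \<Lambda>"
    and "connectedin (cotangent_topology M A) \<Lambda>"
    and "flow_invariant r M A H \<Lambda>"
    and "h = (\<lambda>q. H (q, \<Gamma> q))"
    and "s \<in> {0..1}"
    and "Cns_fun d' s A h"
    and "CARD('d) \<le> d' \<or> (d' = CARD('d) - 1 \<and> s = 1)"
  shows "H constant_on \<Lambda>"
proof (rule constant_on_negligible_connected_image)
  have at: "smooth_atlas M A" and compact: "compact_space M"
    using assms(1) unfolding closed_manifold_def by auto
  have "connectedin euclideanreal (H ` \<Lambda>)"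
    using connectedin_continuous_map_image[OF continuous_map_hamiltonian[OF at assms(3,4)] assms(8)] .
  then show "connected (H ` \<Lambda>)" by simp
  have neg: "negligible ((h \<circ> cinv c) ` cmap c ` (fst ` \<Lambda> \<inter> cdom c))" if c: "c \<in> A" for c
  proof (rule negligible_critical_values)
    show op: "open (cran c)" by (rule open_cran[OF at c])
    have reg: "Cns_on d' s (cran c) (h \<circ> cinv c)" using assms(12) c by (simp add: Cns_fun_def)
    show "Cns_on (DIM(real ^ 'd) - 1) 1 (cran c) (h \<circ> cinv c)"
      using assms(13)
    proof
      assume le: "CARD('d) \<le> d'"
      \<comment> \<open>Since d is at least 1, \<open>d'\<close> is a successor, and its last
        derivative is traded for Lipschitz continuity of the preceding ones.\<close>
      then obtain k where k: "d' = Suc k" "CARD('d) - 1 \<le> k"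
        by (metis Suc_le_D Suc_pred diff_le_mono diff_Suc_1 zero_less_card_finite)
      have "Cns_on k 1 (cran c) (h \<circ> cinv c)" using Cns_on_pred[OF op] reg k(1) by blast
      then show ?thesis using Cns_on_1_antimono[OF op k(2)] by simp
    next
      assume "d' = CARD('d) - 1 \<and> s = 1"
      then show ?thesis using reg by simp
    qed
    show "(h \<circ> cinv c has_derivative (\<lambda>_. 0)) (at x)" if "x \<in> cmap c ` (fst ` \<Lambda> \<inter> cdom c)" for x
      using that critical_on_invariant_set[OF at assms(3-6,9) c] unfolding assms(10) by auto
  qed auto
  \<comment> \<open>Compactness of \<open>M\<close> leaves finitely many charts, so the values of
    \<open>H\<close> on \<open>\<Lambda>\<close> lie in a finite union of null sets.\<close>
  obtain A' where A': "finite A'" "A' \<subseteq> A" "topspace M \<subseteq> (\<Union>c\<in>A'. cdom c)"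
  proof -
    have "\<forall>U\<in>cdom ` A. openin M U" "topspace M \<subseteq> \<Union>(cdom ` A)"
      using at unfolding smooth_atlas_def is_chart_def by auto
    then obtain \<F> where "finite \<F>" "\<F> \<subseteq> cdom ` A" "topspace M \<subseteq> \<Union>\<F>"
      using compact unfolding compact_space_alt by meson
    then show ?thesis using that by (metis finite_subset_image)
  qed
  have "H ` \<Lambda> \<subseteq> (\<Union>c\<in>A'. (h \<circ> cinv c) ` cmap c ` (fst ` \<Lambda> \<inter> cdom c))"
  proof
    fix e assume "e \<in> H ` \<Lambda>"
    then obtain q where q: "(q, \<Gamma> q) \<in> \<Lambda>" "q \<in> topspace M" "e = h q"
      using assms(6,10) unfolding graph_def by auto
    then obtain c where c: "c \<in> A'" "q \<in> cdom c" using A'(3) by blast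
    have "e = (h \<circ> cinv c) (cmap c q)" using cinv_cmap[OF at, of c q] c A'(2) q(3) by auto
    moreover have "q \<in> fst ` \<Lambda> \<inter> cdom c" using q(1) c(2) by force
    ultimately show "e \<in> (\<Union>c\<in>A'. (h \<circ> cinv c) ` cmap c ` (fst ` \<Lambda> \<inter> cdom c))" using c(1) by blast
  qed
  moreover have "negligible (\<Union>c\<in>A'. (h \<circ> cinv c) ` cmap c ` (fst ` \<Lambda> \<inter> cdom c))"
    using A'(1,2) neg by (intro negligible_Union) auto
  ultimately show "negligible (H ` \<Lambda>)" by (rule negligible_subset[rotated])
qed

end
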